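(* Let $m$ be a positive integer, and let $L'$ and $P$ be the $4m\times 4m$ arrays defined in the context. Then $P$ is a critical set contained in the Latin square $L'$ of order $4m$, and $|P|=\frac{23m^2-9m}{2}$. Therefore $\mathrm{lcs}(4m)\ge \frac{23m^2-9m}{2}$.
   Context: A partial Latin square of order $n$ is an $n\times n$ array in which each cell is empty or contains one symbol from a set of $n$ symbols, each symbol occurring at most once in each row and column; it is identified with the set of triples $(i,j;k)$ meaning that symbol $k$ occurs in row $i$, column $j$. Its size is its number of entries; it is a Latin square if it has $n^2$ entries. A critical set in a Latin square $L$ of order $n$ is a proper subset $C\subset L$ such that $L$ is the only Latin square of order $n$ (on the same symbol set) containing $C$, and such that for every $t\in C$ the set $C\setminus\{t\}$ is contained in more than one Latin square of order $n$. $\mathrm{lcs}(n)$ denotes the size of the largest critical set in any Latin square of order $n$. Rows, columns and symbols are numbered from $0$. For a partial Latin square $Q$ of order $m$ on symbols $0,\dots,m-1$ put $$S(Q,x,y,z)=\{(xm+i,\ ym+j;\ zm+k)\mid (i,j;k)\in Q\}.$$ Define the $m\times m$ Latin squares $A=\{(i,j;(i-j)\bmod m)\mid 0\le i,j\le m-1\}$, its transpose $A^T=\{(i,j;(j-i)\bmod m)\mid 0\le i,j\le m-1\}$, and $B=\{(i,j;(i+j)\bmod m)\mid 0\le i,j\le m-1\}$. For an $m\times m$ Latin square $L$ with symbol $L_{ij}$ in cell $(i,j)$ put $$G(L)=\{(i,j;L_{ij})\mid 0\le i,j\le m-1,\ m\le i+j\le 2m-2\},$$ $$H(L)=\{(i,j;L_{ij})\mid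 1\le j\le i\le m-1\},\qquad J(L)=\{(i,j;L_{ij})\mid 1\le i\le j\le m-1\}.$$ Then $$\begin{aligned}L'=\;&S(A,0,0,0)\cup S(A^T,0,1,1)\cup S(A^T,0,2,2)\cup S(B,0,3,3)\\ &\cup S(A,1,0,1)\cup S(A^T,1,1,0)\cup S(B,1,2,3)\cup S(A^T,1,3,2)\\ &\cup S(A,2,0,2)\cup S(B,2,1,3)\cup S(A^T,2,2,0)\cup S(A^T,2,3,1)\\ &\cup S(B,3,0,3)\cup S(A,3,1,2)\cup S(A,3,2,1)\cup S(A,3,3,0),\end{aligned}$$ $$\begin{aligned}P=\;&S(H(A),0,0,0)\cup S(H(A^T),0,1,1)\cup S(H(A^T),0,2,2)\cup S(G(B),0,3,3)\\ &\cup S(J(A),1,0,1)\cup S(A^T,1,1,0)\cup S(G(B),1,2,3)\cup S(A^T,1,3,2)\\ &\cup S(J(A),2,0,2)\cup S(G(B),2,1,3)\cup S(A^T,2,2,0)\cup S(A^T,2,3,1)\\ &\cup S(G(B),3,0,3)\cup S(A,3,1,2)\cup S(A,3,2,1)\cup S(A,3,3,0).\end{aligned}$$ *)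

theory Defs
  imports Complex_Main
begin

type_synonym array = "(nat \<times> nat \<times> nat) set"

text \<open>
  A triple \<open>(i, j, k)\<close> means that symbol \<open>k\<close> occurs in row \<open>i\<close>, column \<open>j\<close>. Rows, columns and
  symbols of an array of order \<open>n\<close> are all numbered \<open>0, \<dots>, n - 1\<close>; fixing the symbol set in this
  way loses nothing, since the notions below are invariant under renaming of symbols.
\<close>

definition partial_latin_square :: "nat \<Rightarrow> array \<Rightarrow> bool" where
  "partial_latin_square n P \<longleftrightarrow>
     P \<subseteq> {..<n} \<times> {..<n} \<times> {..<n} \<and>
     (\<forall>i j k k'. (i, j, k) \<in> P \<and> (i, j, k') \<in> P \<longrightarrow> k = k') \<and>
     (\<forall>i j j' k. (i, j, k) \<in> P \<and> (i, j', k) \<in> P \<longrightarrow> j = j') \<and>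
     (\<forall>i i' j k. (i, j, k) \<in> P \<and> (i', j, k) \<in> P \<longrightarrow> i = i')"

definition latin_square :: "nat \<Rightarrow> array \<Rightarrow> bool" where
  "latin_square n L \<longleftrightarrow> partial_latin_square n L \<and> card L = n\<^sup>2"

definition critical_set :: "nat \<Rightarrow> array \<Rightarrow> array \<Rightarrow> bool" where
  "critical_set n L C \<longleftrightarrow>
     latin_square n L \<and> C \<subset> L \<and>
     (\<forall>M. latin_square n M \<and> C \<subseteq> M \<longrightarrow> M = L) \<and>
     (\<forall>t\<in>C. \<exists>M N. M \<noteq> N \<and> latin_square n M \<and> latin_square n N \<and>
                   C - {t} \<subseteq> M \<and> C - {t} \<subseteq> N)"

text \<open>
  For \<open>n > 0\<close> the maximum is over a nonempty set of sizes bounded by \<open>n\<^sup>2\<close>. For \<open>n = 0\<close> there is no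
  critical set (the only Latin square is empty and has no proper subset) and the value is
  unspecified.
\<close>

definition lcs :: "nat \<Rightarrow> nat" where
  "lcs n = Max {card C | C L. critical_set n L C}"

definition S :: "nat \<Rightarrow> array \<Rightarrow> nat \<Rightarrow> nat \<Rightarrow> nat \<Rightarrow> array" where
  "S m Q x y z = {(x * m + i, y * m + j, z * m + k) | i j k. (i, j, k) \<in> Q}"

text \<open>The differences are taken in the integers, because subtraction on the naturals truncates.\<close>

definition A :: "nat \<Rightarrow> array" where
  "A m = {(i, j, nat ((int i - int j) mod int m)) | i j. i < m \<and> j < m}"

definition AT :: "nat \<Rightarrow> array" where
  "AT m = {(i, j, nat ((int j - int i) mod int m)) | i j. i < m \<and> j < m}"

definition B :: "nat \<Rightarrow> array" where
  "B m = {(i, j, (i + j) mod m) | i j. i < m \<and> j < m}"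

definition G :: "nat \<Rightarrow> array \<Rightarrow> array" where
  "G m L = {(i, j, k) | i j k. (i, j, k) \<in> L \<and> i < m \<and> j < m \<and> m \<le> i + j \<and> i + j \<le> 2 * m - 2}"

definition H :: "nat \<Rightarrow> array \<Rightarrow> array" where
  "H m L = {(i, j, k) | i j k. (i, j, k) \<in> L \<and> 1 \<le> j \<and> j \<le> i \<and> i \<le> m - 1}"

definition J :: "nat \<Rightarrow> array \<Rightarrow> array" where
  "J m L = {(i, j, k) | i j k. (i, j, k) \<in> L \<and> 1 \<le> i \<and> i \<le> j \<and> j \<le> m - 1}"

definition L' :: "nat \<Rightarrow> array" where
  "L' m =
     S m (A m) 0 0 0 \<union> S m (AT m) 0 1 1 \<union> S m (AT m) 0 2 2 \<union> S m (B m) 0 3 3 \<union>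
     S m (A m) 1 0 1 \<union> S m (AT m) 1 1 0 \<union> S m (B m) 1 2 3 \<union> S m (AT m) 1 3 2 \<union>
     S m (A m) 2 0 2 \<union> S m (B m) 2 1 3 \<union> S m (AT m) 2 2 0 \<union> S m (AT m) 2 3 1 \<union>
     S m (B m) 3 0 3 \<union> S m (A m) 3 1 2 \<union> S m (A m) 3 2 1 \<union> S m (A m) 3 3 0"

definition P :: "nat \<Rightarrow> array" where
  "P m =
     S m (H m (A m)) 0 0 0 \<union> S m (H m (AT m)) 0 1 1 \<union> S m (H m (AT m)) 0 2 2 \<union> S m (G m (B m)) 0 3 3 \<union>
     S m (J m (A m)) 1 0 1 \<union> S m (AT m) 1 1 0 \<union> S m (G m (B m)) 1 2 3 \<union> S m (AT m) 1 3 2 \<union>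
     S m (J m (A m)) 2 0 2 \<union> S m (G m (B m)) 2 1 3 \<union> S m (AT m) 2 2 0 \<union> S m (AT m) 2 3 1 \<union>
     S m (G m (B m)) 3 0 3 \<union> S m (A m) 3 1 2 \<union> S m (A m) 3 2 1 \<union> S m (A m) 3 3 0"

end

theory Submission
  imports Defs
begin

text \<open>
  Each of the nine partial blocks \<open>H(A)\<close>, \<open>H(A\<^sup>T)\<close>, \<open>J(A)\<close>, \<open>G(B)\<close> is an isotope of the triangle
  \<open>i + j + k = 2m - 1\<close> in the cyclic square \<open>i + j + k \<equiv> -1 (mod m)\<close>. This triangle is a critical set:
  completion is forced row by row from the bottom, and removing one entry leaves room for a trade
  obtained by cutting a rectangle into squares with the Euclidean algorithm.

  In a completion of \<open>P\<close> the seven filled blocks force, one block after another, which group of \<open>m\<close>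
  symbols each other block uses; so every block is a Latin subsquare and the criticality of the
  partial blocks gives uniqueness. An entry of a partial block can be dropped because the block can
  be replaced by another Latin subsquare, an entry of a filled block because it lies in an
  intercalate whose other entries are not in \<open>P\<close>.
\<close>

text \<open>A trade for one entry of the triangle must spare all its other entries, so everything
  else it removes has to lie in the complementary half \<open>i + j + k + 1 = m\<close> of the
  cyclic square. There a geometric square has two opposite corners on one antidiagonal, hence with
  equal symbols, and this is what makes squares the building pieces. The construction needs a large
  symbol; since the three coordinates of an entry sum to \<open>2 * m - 1\<close>, one of them is
  always large, and the symmetry between rows, columns and symbols reduces to the case that it is
  the symbol.

  The groups of \<open>m\<close> symbols follow the table of the Klein four-group. Two blocks with
  the same group, in different block rows and columns, have side blocks that again share a group;
  hence intercalates across four blocks are possible. The seven filled positions alone determine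
  this 4 by 4 pattern.\<close>

section \<open>Latin squares and critical sets from the cardinality definition\<close>

lemma partial_latin_squareD:
  assumes "partial_latin_square n M"
  shows "M \<subseteq> {..<n} \<times> {..<n} \<times> {..<n}"
    and "(i, j, k) \<in> M \<Longrightarrow> i < n \<and> j < n \<and> k < n"
    and "(i, j, k) \<in> M \<Longrightarrow> (i, j, k') \<in> M \<Longrightarrow> k = k'"
    and "(i, j, k) \<in> M \<Longrightarrow> (i, j', k) \<in> M \<Longrightarrow> j = j'"
    and "(i, j, k) \<in> M \<Longrightarrow> (i', j, k) \<in> M \<Longrightarrow> i = i'"
  using assms unfolding partial_latin_square_def by blast+

lemma latin_square_partial: "latin_square n M \<Longrightarrow> partial_latin_square n M"
  by (simp add: latin_square_def)

lemmas latin_squareD = partial_latin_squareD[OF latin_square_partial]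

lemma finite_latin_square: "latin_square n M \<Longrightarrow> finite M"
  by (rule finite_subset[OF latin_squareD(1)]) auto

lemma latin_square_projection_surj:
  assumes "latin_square n M" "inj_on f M" "f ` M \<subseteq> {..<n} \<times> {..<n}"
  shows "f ` M = {..<n} \<times> {..<n}"
  using assms by (intro card_subset_eq) (auto simp: card_image latin_square_def power2_eq_square)

text \<open>A Latin square is defined by its number of entries, so existence comes from counting:
  each projection to two coordinates is injective into \<open>n * n\<close> pairs, and
  \<open>n\<^sup>2\<close> entries make it onto.\<close>

lemma latin_square_cover:
  assumes "latin_square n M"
  shows "i < n \<Longrightarrow> j < n \<Longrightarrow> \<exists>k<n. (i, j, k) \<in> M"
    and "i < n \<Longrightarrow> k < n \<Longrightarrow> \<exists>j<n. (i, j, k) \<in> M"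
    and "j < n \<Longrightarrow> k < n \<Longrightarrow> \<exists>i<n. (i, j, k) \<in> M"
proof -
  note D = latin_squareD[OF assms]
  have range: "i < n \<and> j < n \<and> k < n" if "(i, j, k) \<in> M" for i j k
    using D(2)[OF that] .
  have rc: "(\<lambda>(i, j, k). (i, j)) ` M = {..<n} \<times> {..<n}"
    by (rule latin_square_projection_surj[OF assms])
      (use range in \<open>auto intro!: inj_onI intro: D(3)\<close>)
  have rs: "(\<lambda>(i, j, k). (i, k)) ` M = {..<n} \<times> {..<n}"
    by (rule latin_square_projection_surj[OF assms])
      (use range in \<open>auto intro!: inj_onI intro: D(4)\<close>)
  have cs: "(\<lambda>(i, j, k). (j, k)) ` M = {..<n} \<times> {..<n}"
    by (rule latin_square_projection_surj[OF assms])
      (use range in \<open>auto intro!: inj_onI intro: D(5)\<close>)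
  show "\<exists>k<n. (i, j, k) \<in> M" if "i < n" "j < n"
  proof -
    have "(i, j) \<in> (\<lambda>(i, j, k). (i, j)) ` M" using rc that by simp
    then obtain k where "(i, j, k) \<in> M" by auto
    then show ?thesis using range by blast
  qed
  show "\<exists>j<n. (i, j, k) \<in> M" if "i < n" "k < n"
  proof -
    have "(i, k) \<in> (\<lambda>(i, j, k). (i, k)) ` M" using rs that by simp
    then obtain j where "(i, j, k) \<in> M" by auto
    then show ?thesis using range by blast
  qed
  show "\<exists>i<n. (i, j, k) \<in> M" if "j < n" "k < n"
  proof -
    have "(j, k) \<in> (\<lambda>(i, j, k). (j, k)) ` M" using cs that by simp
    then obtain i where "(i, j, k) \<in> M" by auto
    then show ?thesis using range by blast
  qed
qed

lemma latin_squareI: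
  assumes "partial_latin_square n M" "\<And>i j. i < n \<Longrightarrow> j < n \<Longrightarrow> \<exists>k. (i, j, k) \<in> M"
  shows "latin_square n M"
proof -
  note D = partial_latin_squareD[OF assms(1)]
  have "(\<lambda>(i, j, k). (i, j)) ` M = {..<n} \<times> {..<n}"
  proof
    show "(\<lambda>(i, j, k). (i, j)) ` M \<subseteq> {..<n} \<times> {..<n}" using D(1) by auto
    show "{..<n} \<times> {..<n} \<subseteq> (\<lambda>(i, j, k). (i, j)) ` M"
    proof
      fix p assume "p \<in> {..<n} \<times> {..<n}"
      then obtain i j where p: "p = (i, j)" "i < n" "j < n" by auto
      with assms(2) obtain k where "(i, j, k) \<in> M" by blast
      then show "p \<in> (\<lambda>(i, j, k). (i, j)) ` M" unfolding p by (rule rev_image_eqI) simp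
    qed
  qed
  moreover have "inj_on (\<lambda>(i, j, k). (i, j)) M"
    by (auto intro!: inj_onI intro: D(3))
  ultimately have "card ({..<n} \<times> {..<n}) = card M" by (metis card_image)
  then show ?thesis using assms(1) by (simp add: latin_square_def power2_eq_square)
qed

lemma latin_square_eqI:
  assumes "latin_square n M" "latin_square n N" "M \<subseteq> N"
  shows "M = N"
  using assms finite_latin_square by (intro card_subset_eq) (auto simp: latin_square_def)

text \<open>\<open>L\<close> itself completes every \<open>C - {t}\<close>, so one further
  completion suffices. For uniqueness an inclusion is enough, because Latin squares of equal order
  have equally many entries.\<close>

lemma critical_setI:
  assumes "latin_square n L" "C \<subset> L"
    and "\<And>M. latin_square n M \<Longrightarrow> C \<subseteq> M \<Longrightarrow> L \<subseteq> M"
    and "\<And>t. t \<in> C \<Longrightarrow> \<exists>M. latin_square n M \<and> C - {t} \<subseteq> M \<and> M \<noteq> L"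
  shows "critical_set n L C"
proof -
  have "\<exists>M N. M \<noteq> N \<and> latin_square n M \<and> latin_square n N \<and> C - {t} \<subseteq> M \<and> C - {t} \<subseteq> N"
    if "t \<in> C" for t using assms(4)[OF that] assms(1,2) by blast
  moreover have "M = L" if "latin_square n M" "C \<subseteq> M" for M
    using latin_square_eqI[OF assms(1) that(1) assms(3)[OF that]] by simp
  ultimately show ?thesis unfolding critical_set_def using assms(1,2) by blast
qed

lemma critical_setD:
  assumes "critical_set n L C"
  shows "latin_square n L" "C \<subset> L"
    and "latin_square n M \<Longrightarrow> C \<subseteq> M \<Longrightarrow> M = L"
    and "t \<in> C \<Longrightarrow> \<exists>M. latin_square n M \<and> C - {t} \<subseteq> M \<and> M \<noteq> L"
proof -
  show "t \<in> C \<Longrightarrow> \<exists>M. latin_square n M \<and> C - {t} \<subseteq> M \<and> M \<noteq> L"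
    using assms unfolding critical_set_def by metis
qed (use assms in \<open>auto simp: critical_set_def\<close>)

section \<open>Isotopy\<close>

text \<open>Negation modulo \<open>m\<close> on the representatives below \<open>m\<close>;
  \<open>0\<close> is separate because \<open>m - 0\<close> would leave the range.\<close>

definition neg :: "nat \<Rightarrow> nat \<Rightarrow> nat" where
  "neg m i = (if i = 0 then 0 else m - i)"

definition reflect :: "nat \<Rightarrow> nat \<Rightarrow> nat" where
  "reflect m i = m - 1 - i"

text \<open>Formed as a preimage, so that membership unfolds without an existential
  quantifier.\<close>

definition isotope :: "nat \<Rightarrow> (nat \<Rightarrow> nat) \<Rightarrow> (nat \<Rightarrow> nat) \<Rightarrow> (nat \<Rightarrow> nat) \<Rightarrow> array \<Rightarrow> array" where
  "isotope m f g h Q = {(i, j, k). i < m \<and> j < m \<and> k < m \<and> (f i, g j, h k) \<in> Q}"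

definition inverses :: "nat \<Rightarrow> (nat \<Rightarrow> nat) \<Rightarrow> (nat \<Rightarrow> nat) \<Rightarrow> bool" where
  "inverses m f f' \<longleftrightarrow> (\<forall>i<m. f i < m \<and> f' i < m \<and> f' (f i) = i \<and> f (f' i) = i)"

lemma inverses_sym: "inverses m f f' \<Longrightarrow> inverses m f' f"
  by (auto simp: inverses_def)

lemma reflect_involution:
  "i < m \<Longrightarrow> neg m i < m" "i < m \<Longrightarrow> neg m (neg m i) = i"
  "i < m \<Longrightarrow> reflect m i < m" "i < m \<Longrightarrow> reflect m (reflect m i) = i"
  by (auto simp: neg_def reflect_def)

lemma inverses_inst:
  "inverses m id id" "inverses m (neg m) (neg m)" "inverses m (reflect m) (reflect m)"
  "inverses m (reflect m \<circ> neg m) (neg m \<circ> reflect m)"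
  by (simp_all add: inverses_def reflect_involution)

lemma latin_square_isotope:
  assumes Q: "latin_square m Q"
    and f: "inverses m f f'" and g: "inverses m g g'" and h: "inverses m h h'"
  shows "latin_square m (isotope m f g h Q)"
proof (rule latin_squareI)
  note D = latin_squareD[OF Q]
  show "partial_latin_square m (isotope m f g h Q)"
    unfolding partial_latin_square_def isotope_def
  proof (intro conjI allI impI; clarsimp)
    fix i j k k' assume "(f i, g j, h k) \<in> Q" "(f i, g j, h k') \<in> Q" "k < m" "k' < m"
    then show "k = k'" using D(3) h unfolding inverses_def by metis
  next
    fix i j j' k assume "(f i, g j, h k) \<in> Q" "(f i, g j', h k) \<in> Q" "j < m" "j' < m"
    then show "j = j'" using D(4) g unfolding inverses_def by metis
  next
    fix i i' j k assume "(f i, g j, h k) \<in> Q" "(f i', g j, h k) \<in> Q" "i < m" "i' < m"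
    then show "i = i'" using D(5) f unfolding inverses_def by metis
  qed
  fix i j assume ij: "i < m" "j < m"
  then obtain k where "k < m" "(f i, g j, k) \<in> Q"
    using latin_square_cover(1)[OF Q, of "f i" "g j"] f g by (auto simp: inverses_def)
  then have "(i, j, h' k) \<in> isotope m f g h Q"
    using ij h by (auto simp: isotope_def inverses_def)
  then show "\<exists>k. (i, j, k) \<in> isotope m f g h Q" ..
qed

lemma isotope_inverse:
  assumes "Q \<subseteq> {..<m} \<times> {..<m} \<times> {..<m}"
    and "inverses m f f'" "inverses m g g'" "inverses m h h'"
  shows "isotope m f' g' h' (isotope m f g h Q) = Q"
proof (rule set_eqI)
  fix e :: "nat \<times> nat \<times> nat"
  obtain i j k where e: "e = (i, j, k)" by (cases e)
  show "e \<in> isotope m f' g' h' (isotope m f g h Q) \<longleftrightarrow> e \<in> Q"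
  proof (cases "i < m \<and> j < m \<and> k < m")
    case True
    then show ?thesis using assms(2-4) by (simp add: e isotope_def inverses_def)
  next
    case False
    then show ?thesis using assms(1) by (auto simp: e isotope_def)
  qed
qed

lemma isotope_mono: "R \<subseteq> Q \<Longrightarrow> isotope m f g h R \<subseteq> isotope m f g h Q"
  unfolding isotope_def by blast

text \<open>An isotopy permutes the Latin squares of order \<open>m\<close> and respects inclusion,
  so completions of the image correspond to completions of the original.\<close>

lemma critical_set_isotope:
  assumes crit: "critical_set m Q R"
    and f: "inverses m f f'" and g: "inverses m g g'" and h: "inverses m h h'"
  shows "critical_set m (isotope m f g h Q) (isotope m f g h R)"
proof (rule critical_setI)
  let ?I = "isotope m f g h" and ?I' = "isotope m f' g' h'"
  note C = critical_setD[OF crit]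
  note f' = inverses_sym[OF f] and g' = inverses_sym[OF g] and h' = inverses_sym[OF h]
  have I'I: "?I' (?I X) = X" if "X \<subseteq> {..<m} \<times> {..<m} \<times> {..<m}" for X
    using isotope_inverse[OF that f g h] .
  have II': "?I (?I' X) = X" if "X \<subseteq> {..<m} \<times> {..<m} \<times> {..<m}" for X
    using isotope_inverse[OF that f' g' h'] .
  have Qsub: "Q \<subseteq> {..<m} \<times> {..<m} \<times> {..<m}" using latin_squareD(1)[OF C(1)] .
  then have Rsub: "R \<subseteq> {..<m} \<times> {..<m} \<times> {..<m}" using C(2) by blast
  show "latin_square m (?I Q)" using latin_square_isotope[OF C(1) f g h] .
  show "?I R \<subset> ?I Q"
    using isotope_mono[of R Q] C(2) I'I[OF Qsub] I'I[OF Rsub] by (metis psubset_eq)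
  show "?I Q \<subseteq> N" if N: "latin_square m N" "?I R \<subseteq> N" for N
  proof -
    have "?I' N = Q"
      using C(3)[of "?I' N"] latin_square_isotope[OF N(1) f' g' h'] isotope_mono[OF N(2), of m f' g' h']
        I'I[OF Rsub] by simp
    then show ?thesis using II'[OF latin_squareD(1)[OF N(1)]] by simp
  qed
  fix t assume "t \<in> ?I R"
  then obtain i j k where t: "t = (i, j, k)" "i < m" "j < m" "k < m" "(f i, g j, h k) \<in> R"
    by (auto simp: isotope_def)
  from C(4)[OF t(5)] obtain M where M: "latin_square m M" "R - {(f i, g j, h k)} \<subseteq> M" "M \<noteq> Q"
    by blast
  have "?I R - {t} \<subseteq> ?I M"
  proof
    fix e assume e: "e \<in> ?I R - {t}"
    obtain a b c where e': "e = (a, b, c)" by (cases e)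
    with e have "a < m" "b < m" "c < m" "(f a, g b, h c) \<in> R" "(a, b, c) \<noteq> (i, j, k)"
      using t(1) by (auto simp: isotope_def)
    moreover from this have "(f a, g b, h c) \<noteq> (f i, g j, h k)"
      using f g h t(2-4) unfolding inverses_def by (metis prod.inject)
    ultimately show "e \<in> ?I M" using M(2) e' by (auto simp: isotope_def)
  qed
  moreover have "?I M \<noteq> ?I Q" using I'I[OF Qsub] I'I[OF latin_squareD(1)[OF M(1)]] M(3) by metis
  ultimately show "\<exists>M. latin_square m M \<and> ?I R - {t} \<subseteq> M \<and> M \<noteq> ?I Q"
    using latin_square_isotope[OF M(1) f g h] by blast
qed

section \<open>The cyclic square\<close>

text \<open>
  The symbol \<open>k\<close> of \<open>B m\<close> becomes \<open>m - 1 - k\<close>, so that \<open>cyclic\<close> and \<open>triangle\<close> are invariant under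
  permuting rows, columns and symbols.
\<close>

definition cyclic :: "nat \<Rightarrow> array" where
  "cyclic m = {(i, j, k). i < m \<and> j < m \<and> k < m \<and> (i + j + k + 1 = m \<or> i + j + k + 1 = 2 * m)}"

definition triangle :: "nat \<Rightarrow> array" where
  "triangle m = {(i, j, k). i < m \<and> j < m \<and> k < m \<and> i + j + k + 1 = 2 * m}"

lemma latin_square_cyclic: "latin_square m (cyclic m)"
proof (rule latin_squareI)
  show "partial_latin_square m (cyclic m)"
    unfolding partial_latin_square_def cyclic_def
    by (intro conjI subsetI allI impI; clarsimp; elim disjE; linarith)
  show "\<exists>k. (i, j, k) \<in> cyclic m" if "i < m" "j < m" for i j
    using that by (intro exI[of _ "if i + j < m then m - 1 - i - j else 2 * m - 1 - i - j"])
      (auto simp: cyclic_def)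
qed

lemma triangle_determines_cyclic:
  assumes M: "latin_square m M" and sub: "triangle m \<subseteq> M"
  shows "cyclic m \<subseteq> M"
proof -
  note D = latin_squareD[OF M]
  have tri: "(i, j, k) \<in> M" if "i < m" "j < m" "k < m" "i + j + k + 1 = 2 * m" for i j k
    using that by (intro subsetD[OF sub]) (simp add: triangle_def)
  \<comment> \<open>Here \<open>j + k = m - 1 - i\<close>, so the outer induction climbs from row
    \<open>m - 1\<close>; the inner one goes through a row from left to right.\<close>
  have low: "(i, j, k) \<in> M" if "i + j + k + 1 = m" for i j k
    using that
  proof (induction "j + k" arbitrary: i j k rule: less_induct)
    case less
    note outer = less
    show ?case using less(2)
    proof (induction j arbitrary: k rule: less_induct)
      case (less j)
      from less(2) obtain k' where k': "k' < m" "(i, j, k') \<in> M"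
        using latin_square_cover(1)[OF M, of i j] by auto
      \<comment> \<open>A symbol \<open>k'\<close> other than \<open>k\<close> is already placed
        elsewhere: in row \<open>i\<close> by the triangle, in column \<open>j\<close> by a lower
        row, or in row \<open>i\<close> by an earlier column.\<close>
      consider "i + k' \<ge> m" | "i + j + k' + 1 < m" | "i + k' < m" "i + j + k' + 1 > m" | "k' = k"
        using less(2) by linarith
      then show ?case
      proof cases
        case 1
        with k' less(2) have "(i, 2 * m - 1 - i - k', k') \<in> M" by (intro tri) linarith+
        from D(4)[OF k'(2) this] show ?thesis using 1 k'(1) less(2) by simp
      next
        case 2
        then have "(m - 1 - j - k', j, k') \<in> M"
          using outer(2) less(2) by (intro outer(1)) linarith+
        from D(5)[OF k'(2) this] show ?thesis using 2 by simp
      next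
        case 3
        then have "(i, m - 1 - i - k', k') \<in> M" by (intro less(1)) linarith+
        from D(4)[OF k'(2) this] show ?thesis using 3 by simp
      next
        case 4
        with k' show ?thesis by simp
      qed
    qed
  qed
  show ?thesis
  proof
    fix e assume "e \<in> cyclic m"
    then obtain i j k where "e = (i, j, k)" "i < m" "j < m" "k < m"
      "i + j + k + 1 = m \<or> i + j + k + 1 = 2 * m"
      unfolding cyclic_def by blast
    then show "e \<in> M" using tri low by blast
  qed
qed

section \<open>Trades in the cyclic square\<close>

text \<open>A difference of two point masses; a product of two of them marks the corners of a
  rectangle with alternating signs.\<close>

definition diff :: "nat \<Rightarrow> nat \<Rightarrow> nat \<Rightarrow> int" where
  "diff a b i = of_bool (i = a) - of_bool (i = b)"

text \<open>
  A trade is encoded by its signed indicator: \<open>+1\<close> for triples put in, \<open>-1\<close> for triples taken out.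
  For the trades on a rectangle only the row-column sums at the four corners do not vanish; they
  cancel against those of \<open>square\<close>, so that rectangles can be glued along a common side.
\<close>

definition rectangle_trade ::
    "nat \<Rightarrow> nat \<Rightarrow> nat \<Rightarrow> nat \<Rightarrow> nat \<Rightarrow> (nat \<Rightarrow> nat \<Rightarrow> nat \<Rightarrow> int) \<Rightarrow> bool" where
  "rectangle_trade m x x' y y' w \<longleftrightarrow>
    (\<forall>i j. (\<Sum>k<m. w i j k) = diff x x' i * diff y y' j) \<and>
    (\<forall>i k. (\<Sum>j<m. w i j k) = 0) \<and> (\<forall>j k. (\<Sum>i<m. w i j k) = 0) \<and>
    (\<forall>i j k. w i j k \<ge> -1) \<and>
    (\<forall>i j k. w i j k < 0 \<longrightarrow> i + j + k + 1 = m \<and> x \<le> i \<and> i \<le> x' \<and> y \<le> j \<and> j \<le> y' \<and>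
       (i, j) \<noteq> (x, y) \<and> (i, j) \<noteq> (x', y'))"

text \<open>The equation \<open>i + j + k + 1 = m\<close> is symmetric in \<open>i\<close> and
  \<open>j\<close>, so the Euclidean algorithm may cut along either side.\<close>

lemma rectangle_trade_swap:
  assumes "rectangle_trade m x x' y y' w"
  shows "rectangle_trade m y y' x x' (\<lambda>i j. w j i)"
proof -
  have "i + j + k + 1 = m \<and> y \<le> i \<and> i \<le> y' \<and> x \<le> j \<and> j \<le> x' \<and>
       (i, j) \<noteq> (y, x) \<and> (i, j) \<noteq> (y', x')" if "w j i k < 0" for i j k
    using assms that unfolding rectangle_trade_def by (metis add.commute prod.inject)
  moreover have "(\<Sum>k<m. w i j k) = diff x x' i * diff y y' j"
    "(\<Sum>j<m. w i j k) = 0" "(\<Sum>i<m. w i j k) = 0" "w i j k \<ge> -1" for i j k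
    using assms unfolding rectangle_trade_def by blast+
  ultimately show ?thesis unfolding rectangle_trade_def by (simp add: mult.commute)
qed

lemma sum_diff: "a < m \<Longrightarrow> b < m \<Longrightarrow> (\<Sum>i<m. diff a b i) = 0"
  by (simp add: diff_def sum_subtractf of_bool_def)

definition square :: "nat \<Rightarrow> nat \<Rightarrow> nat \<Rightarrow> nat \<Rightarrow> nat \<Rightarrow> nat \<Rightarrow> nat \<Rightarrow> nat \<Rightarrow> int" where
  "square c x x' y y' i j k = diff x x' i * diff y y' j * of_bool (k = c)"

lemma sum_square:
  assumes "x < m" "x' < m" "y < m" "y' < m" "c < m"
  shows "(\<Sum>k<m. square c x x' y y' i j k) = diff x x' i * diff y y' j"
    and "(\<Sum>j<m. square c x x' y y' i j k) = 0"
    and "(\<Sum>i<m. square c x x' y y' i j k) = 0"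
proof -
  have "(\<Sum>k<m. square c x x' y y' i j k) = diff x x' i * diff y y' j * (\<Sum>k<m. of_bool (k = c))"
    by (simp only: square_def sum_distrib_left)
  also have "(\<Sum>k<m. of_bool (k = c)) = (1 :: int)" using assms by (simp add: of_bool_def)
  finally show "(\<Sum>k<m. square c x x' y y' i j k) = diff x x' i * diff y y' j" by simp
  have "(\<Sum>j<m. square c x x' y y' i j k) = diff x x' i * (\<Sum>j<m. diff y y' j) * of_bool (k = c)"
    by (simp only: square_def sum_distrib_left sum_distrib_right)
  then show "(\<Sum>j<m. square c x x' y y' i j k) = 0" using assms by (simp add: sum_diff)
  have "(\<Sum>i<m. square c x x' y y' i j k) = (\<Sum>i<m. diff x x' i) * diff y y' j * of_bool (k = c)"
    by (simp only: square_def sum_distrib_right)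
  then show "(\<Sum>i<m. square c x x' y y' i j k) = 0" using assms by (simp add: sum_diff)
qed

lemma square_negative:
  assumes "x \<noteq> x'" "y \<noteq> y'"
  shows "square c x x' y y' i j k \<ge> -1"
    and "square c x x' y y' i j k < 0 \<Longrightarrow> k = c \<and> (i = x \<and> j = y' \<or> i = x' \<and> j = y)"
  using assms by (auto simp: square_def diff_def of_bool_def split: if_splits)

lemma square_positive:
  assumes "x \<noteq> x'" "y \<noteq> y'"
  shows "square c x x' y y' i j k \<le> 1"
    and "square c x x' y y' i j k > 0 \<Longrightarrow> k = c \<and> (i = x \<and> j = y \<or> i = x' \<and> j = y')"
  using assms by (auto simp: square_def diff_def of_bool_def split: if_splits)

text \<open>In a geometric square the corners \<open>(x, y')\<close> and \<open>(x', y)\<close> lie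
  on one antidiagonal and so both carry \<open>c\<close> in \<open>cyclic m\<close>; the trade moves
  \<open>c\<close> to the other two corners.\<close>

lemma rectangle_trade_square:
  assumes "x < x'" "y < y'" "x' < m" "y' < m" "x' + y = x + y'" "x + y' + c + 1 = m"
  shows "rectangle_trade m x x' y y' (square c x x' y y')"
proof -
  have m: "x < m" "y < m" "c < m" and ne: "x \<noteq> x'" "y \<noteq> y'" using assms by auto
  have "i + j + k + 1 = m \<and> x \<le> i \<and> i \<le> x' \<and> y \<le> j \<and> j \<le> y' \<and>
       (i, j) \<noteq> (x, y) \<and> (i, j) \<noteq> (x', y')" if "square c x x' y y' i j k < 0" for i j k
    using square_negative(2)[OF ne that] assms by auto
  then show ?thesis
    unfolding rectangle_trade_def
    using sum_square[OF m(1) assms(3) m(2) assms(4) m(3)] square_negative(1)[OF ne] by simp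
qed

text \<open>Along the common side \<open>j = e\<close> the corner signs telescope. The new square
  takes \<open>c\<close> out at \<open>(x', e)\<close>; \<open>w\<close> takes nothing out in that
  cell, because \<open>rectangle_trade\<close> exempts its corner \<open>(x', y')\<close>, so no
  coefficient drops below \<open>-1\<close>.\<close>

lemma rectangle_trade_extend:
  assumes w: "rectangle_trade m x x' y e w"
    and less: "x < x'" "y < e" "e < y'" "x' < m" "y' < m"
    and eq: "x' + e = x + y'" "x + y' + c + 1 = m"
  shows "rectangle_trade m x x' y y' (\<lambda>i j k. w i j k + square c x x' e y' i j k)"
proof -
  let ?q = "square c x x' e y'"
  have ne: "x \<noteq> x'" "e \<noteq> y'" using less by auto
  have w_neg: "i + j + k + 1 = m \<and> x \<le> i \<and> i \<le> x' \<and> y \<le> j \<and> j \<le> e \<and>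
      (i, j) \<noteq> (x, y) \<and> (i, j) \<noteq> (x', e)" if "w i j k < 0" for i j k
    using w that unfolding rectangle_trade_def by blast
  have w_ge: "w i j k \<ge> -1" for i j k
    using w unfolding rectangle_trade_def by blast
  have q_neg: "i + j + k + 1 = m \<and> (i = x \<and> j = y' \<or> i = x' \<and> j = e)" if "?q i j k < 0" for i j k
    using square_negative(2)[OF ne that] eq by auto
  have q_ge: "?q i j k \<ge> -1" for i j k
    using square_negative(1)[OF ne] .
  have disj: "\<not> (w i j k < 0 \<and> ?q i j k < 0)" for i j k
    using w_neg[of i j k] q_neg[of i j k] less by auto
  have ge: "w i j k + ?q i j k \<ge> -1" for i j k
    using disj[of i j k] w_ge[of i j k] q_ge[of i j k] by linarith
  have neg: "i + j + k + 1 = m \<and> x \<le> i \<and> i \<le> x' \<and> y \<le> j \<and> j \<le> y' \<and>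
       (i, j) \<noteq> (x, y) \<and> (i, j) \<noteq> (x', y')" if "w i j k + ?q i j k < 0" for i j k
  proof -
    from that consider "w i j k < 0" | "?q i j k < 0" by linarith
    then show ?thesis
      by cases (use w_neg[of i j k] q_neg[of i j k] less in auto)
  qed
  have "diff y e j + diff e y' j = diff y y' j" for j by (simp add: diff_def)
  then have rc: "diff x x' i * diff y e j + diff x x' i * diff e y' j = diff x x' i * diff y y' j" for i j
    by (metis distrib_left)
  have m: "x < m" "e < m" "c < m" using less eq by auto
  have sw: "(\<Sum>k<m. w i j k) = diff x x' i * diff y e j"
    "(\<Sum>j<m. w i j k) = 0" "(\<Sum>i<m. w i j k) = 0" for i j k
    using w unfolding rectangle_trade_def by blast+
  note sq = sum_square[OF m(1) less(4) m(2) less(5) m(3)]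
  show ?thesis
    unfolding rectangle_trade_def using ge neg by (simp add: sum.distrib sw sq rc)
qed

text \<open>Euclidean algorithm: cut a square off the rectangle at the corner \<open>(x', y')\<close>.\<close>

lemma rectangle_trade_exists:
  assumes "x < x'" "y < y'" "x' < m" "y' < m" "x' + y' < m + min (x' - x) (y' - y)"
  shows "\<exists>w. rectangle_trade m x x' y y' w"
  using assms
proof (induction "x' - x + (y' - y)" arbitrary: x x' y y' rule: less_induct)
  case less
  \<comment> \<open>Stated for fresh variables with the longer side second; the opposite case
    applies it to the transposed rectangle.\<close>
  have step: "\<exists>w. rectangle_trade m x x' y y' w"
    if IH: "\<And>e. y < e \<Longrightarrow> e < y' \<Longrightarrow> x' + e < m + min (x' - x) (e - y) \<Longrightarrow>
        \<exists>w. rectangle_trade m x x' y e w"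
      and A: "x < x'" "y < y'" "x' < m" "y' < m" "x' + y' < m + (x' - x)" "x' - x \<le> y' - y"
    for x x' y y'
  proof -
    \<comment> \<open>\<open>e\<close> makes the piece cut off a square. The bound in
      \<open>A\<close> says \<open>x + y' < m\<close>, so its antidiagonal has a symbol
      \<open>c\<close>; since \<open>x' + e = x + y'\<close>, the same bound serves the remaining
      rectangle.\<close>
    define e c where "e = y' - (x' - x)" and "c = m - 1 - (x + y')"
    have ec: "e < y'" "x' + e = x + y'" "x + y' + c + 1 = m" "y \<le> e" using A by (auto simp: e_def c_def)
    show ?thesis
    proof (cases "y = e")
      case True
      then show ?thesis using rectangle_trade_square[of x x' y y' m c] A ec by blast
    next
      case False
      then have "y < e" using ec by simp
      moreover obtain w where "rectangle_trade m x x' y e w"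
        using IH[OF \<open>y < e\<close> ec(1)] ec A by fastforce
      ultimately show ?thesis using rectangle_trade_extend[of m x x' y e w y' c] A ec by blast
    qed
  qed
  show ?case
  proof (cases "x' - x \<le> y' - y")
    case True
    show ?thesis
    proof (rule step)
      fix e assume "y < e" "e < y'" "x' + e < m + min (x' - x) (e - y)"
      then show "\<exists>w. rectangle_trade m x x' y e w"
        using less.prems(1,3,4) by (intro less.hyps) linarith+
    next
      show "x' + y' < m + (x' - x)" using less.prems(5) by linarith
    qed (use True less.prems in blast)+
  next
    case False
    have "\<exists>w. rectangle_trade m y y' x x' w"
    proof (rule step)
      fix e assume e: "x < e" "e < x'" "y' + e < m + min (y' - y) (e - x)"
      then have "e + y' < m + min (e - x) (y' - y)" by linarith
      then have "\<exists>w. rectangle_trade m x e y y' w"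
        using less.prems(2-4) e(1,2) by (intro less.hyps) linarith+
      then show "\<exists>w. rectangle_trade m y y' x e w" using rectangle_trade_swap by blast
    next
      show "y' + x' < m + (y' - y)" using less.prems(5) by linarith
      show "y' - y \<le> x' - x" using False by linarith
    qed (use less.prems in blast)+
    then show ?thesis using rectangle_trade_swap by blast
  qed
qed

section \<open>Latin squares as nonnegative integer arrays with line sums 1\<close>

lemma sum_of_bool_unique:
  fixes m :: nat
  assumes "k0 < m" "\<And>k. k < m \<Longrightarrow> Q k \<longleftrightarrow> k = k0"
  shows "(\<Sum>k<m. of_bool (Q k)) = (1 :: int)"
proof -
  have "(\<Sum>k<m. of_bool (Q k)) = (\<Sum>k<m. of_bool (k = k0) :: int)"
    using assms(2) by (intro sum.cong) auto
  also have "\<dots> = 1" using assms(1) by (simp add: of_bool_def)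
  finally show ?thesis .
qed

lemma sum_indicator_latin_square:
  assumes M: "latin_square m M"
  shows "i < m \<Longrightarrow> j < m \<Longrightarrow> (\<Sum>k<m. of_bool ((i, j, k) \<in> M)) = (1 :: int)"
    and "i < m \<Longrightarrow> k < m \<Longrightarrow> (\<Sum>j<m. of_bool ((i, j, k) \<in> M)) = (1 :: int)"
    and "j < m \<Longrightarrow> k < m \<Longrightarrow> (\<Sum>i<m. of_bool ((i, j, k) \<in> M)) = (1 :: int)"
proof -
  note D = latin_squareD[OF M]
  show "(\<Sum>k<m. of_bool ((i, j, k) \<in> M)) = (1 :: int)" if "i < m" "j < m"
    using latin_square_cover(1)[OF M that] D(3) by (metis sum_of_bool_unique)
  show "(\<Sum>j<m. of_bool ((i, j, k) \<in> M)) = (1 :: int)" if "i < m" "k < m"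
    using latin_square_cover(2)[OF M that] D(4) by (metis sum_of_bool_unique)
  show "(\<Sum>i<m. of_bool ((i, j, k) \<in> M)) = (1 :: int)" if "j < m" "k < m"
    using latin_square_cover(3)[OF M that] D(5) by (metis sum_of_bool_unique)
qed

lemma sum_eq_one:
  fixes f :: "nat \<Rightarrow> int"
  assumes "\<And>x. x < m \<Longrightarrow> f x \<ge> 0" "(\<Sum>x<m. f x) = 1"
  shows "x < m \<Longrightarrow> f x \<noteq> 0 \<Longrightarrow> f x = 1"
    and "\<exists>x<m. f x = 1"
    and "x < m \<Longrightarrow> y < m \<Longrightarrow> f x = 1 \<Longrightarrow> f y = 1 \<Longrightarrow> x = y"
proof -
  have le: "f x \<le> 1" if "x < m" for x
    using member_le_sum[of x "{..<m}" f] assms that by auto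
  show one: "f x = 1" if "x < m" "f x \<noteq> 0" for x
    using le[OF that(1)] assms(1)[OF that(1)] that(2) by linarith
  have "\<exists>x<m. f x \<noteq> 0"
  proof (rule ccontr)
    assume "\<not> ?thesis"
    then have "(\<Sum>x<m. f x) = 0" by (intro sum.neutral) auto
    then show False using assms(2) by simp
  qed
  then show "\<exists>x<m. f x = 1" using one by blast
  show "x = y" if "x < m" "y < m" "f x = 1" "f y = 1"
  proof (rule ccontr)
    assume "x \<noteq> y"
    then have "2 = (\<Sum>x\<in>{x, y}. f x)" using that by simp
    also have "\<dots> \<le> (\<Sum>x<m. f x)" using assms(1) that by (intro sum_mono2) auto
    finally show False using assms(2) by simp
  qed
qed

text \<open>Nonnegative integers with sum 1 along a line are 0 except for a single 1, so such an
  array is the indicator of a Latin square.\<close>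

lemma latin_square_of_weights:
  fixes g :: "nat \<Rightarrow> nat \<Rightarrow> nat \<Rightarrow> int"
  assumes ge: "\<And>i j k. i < m \<Longrightarrow> j < m \<Longrightarrow> k < m \<Longrightarrow> g i j k \<ge> 0"
    and rc: "\<And>i j. i < m \<Longrightarrow> j < m \<Longrightarrow> (\<Sum>k<m. g i j k) = 1"
    and rs: "\<And>i k. i < m \<Longrightarrow> k < m \<Longrightarrow> (\<Sum>j<m. g i j k) = 1"
    and cs: "\<And>j k. j < m \<Longrightarrow> k < m \<Longrightarrow> (\<Sum>i<m. g i j k) = 1"
  shows "latin_square m {(i, j, k). i < m \<and> j < m \<and> k < m \<and> g i j k \<noteq> 0}"
proof -
  define M where "M = {(i, j, k). i < m \<and> j < m \<and> k < m \<and> g i j k \<noteq> 0}"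
  have one: "g i j k = 1" if "i < m" "j < m" "k < m" "g i j k \<noteq> 0" for i j k
    by (rule sum_eq_one(1)[of m "g i j", OF ge[OF that(1,2)] rc[OF that(1,2)] that(3,4)])
  have mem: "i < m \<and> j < m \<and> k < m \<and> g i j k = 1" if "(i, j, k) \<in> M" for i j k
    using that one by (simp add: M_def)
  have "k = k'" if "(i, j, k) \<in> M" "(i, j, k') \<in> M" for i j k k'
    using mem[OF that(1)] mem[OF that(2)] sum_eq_one(3)[of m "g i j", OF ge rc] by blast
  moreover have "j = j'" if "(i, j, k) \<in> M" "(i, j', k) \<in> M" for i j j' k
    using mem[OF that(1)] mem[OF that(2)] sum_eq_one(3)[of m "\<lambda>j. g i j k", OF ge rs] by blast
  moreover have "i = i'" if "(i, j, k) \<in> M" "(i', j, k) \<in> M" for i i' j k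
    using mem[OF that(1)] mem[OF that(2)] sum_eq_one(3)[of m "\<lambda>i. g i j k", OF ge cs] by blast
  moreover have "M \<subseteq> {..<m} \<times> {..<m} \<times> {..<m}" by (auto simp: M_def)
  ultimately have "partial_latin_square m M"
    unfolding partial_latin_square_def by blast
  moreover have "\<exists>k. (i, j, k) \<in> M" if ij: "i < m" "j < m" for i j
  proof -
    obtain k where "k < m" "g i j k = 1"
      using sum_eq_one(2)[of m "g i j", OF ge rc] ij by blast
    then have "(i, j, k) \<in> M" using ij by (simp add: M_def)
    then show ?thesis ..
  qed
  ultimately show ?thesis unfolding M_def by (rule latin_squareI)
qed

text \<open>As the result is recognised by its line sums, a trade only needs vanishing line sums and
  a lower bound; overlaps and cancellations among its squares need no bookkeeping.\<close>

lemma latin_square_add_trade: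
  fixes w :: "nat \<Rightarrow> nat \<Rightarrow> nat \<Rightarrow> int"
  assumes L: "latin_square m L"
    and rc: "\<And>i j. (\<Sum>k<m. w i j k) = 0"
    and rs: "\<And>i k. (\<Sum>j<m. w i j k) = 0"
    and cs: "\<And>j k. (\<Sum>i<m. w i j k) = 0"
    and ge: "\<And>i j k. i < m \<Longrightarrow> j < m \<Longrightarrow> k < m \<Longrightarrow> w i j k \<ge> - of_bool ((i, j, k) \<in> L)"
  shows "latin_square m {(i, j, k). i < m \<and> j < m \<and> k < m \<and> of_bool ((i, j, k) \<in> L) + w i j k \<noteq> 0}"
proof (rule latin_square_of_weights)
  note ind = sum_indicator_latin_square[OF L]
  show "of_bool ((i, j, k) \<in> L) + w i j k \<ge> 0" if "i < m" "j < m" "k < m" for i j k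
    using ge[OF that] by linarith
  show "(\<Sum>k<m. of_bool ((i, j, k) \<in> L) + w i j k) = 1" if "i < m" "j < m" for i j
    by (simp only: sum.distrib ind(1)[OF that] rc add_0_right)
  show "(\<Sum>j<m. of_bool ((i, j, k) \<in> L) + w i j k) = 1" if "i < m" "k < m" for i k
    by (simp only: sum.distrib ind(2)[OF that] rs add_0_right)
  show "(\<Sum>i<m. of_bool ((i, j, k) \<in> L) + w i j k) = 1" if "j < m" "k < m" for j k
    by (simp only: sum.distrib ind(3)[OF that] cs add_0_right)
qed

text \<open>The switch is the difference of the \<open>square\<close> for \<open>u\<close> and the
  one for \<open>s\<close> on the same corners, whose row-column sums cancel.\<close>

lemma intercalate_switch:
  assumes L: "latin_square n L"
    and mem: "(a, b, s) \<in> L" "(a', b', s) \<in> L" "(a, b', u) \<in> L" "(a', b, u) \<in> L"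
    and ne: "a \<noteq> a'" "b \<noteq> b'"
  shows "\<exists>M. latin_square n M \<and> L - {(a, b, s), (a', b', s), (a, b', u), (a', b, u)} \<subseteq> M \<and> M \<noteq> L"
proof -
  note D = latin_squareD[OF L]
  have "s \<noteq> u" using D(4)[OF mem(1)] mem(3) ne by blast
  let ?s = "square s a a' b b'" and ?u = "square u a a' b b'"
  define w where "w i j k = ?u i j k - ?s i j k" for i j k
  have lt: "a < n" "a' < n" "b < n" "b' < n" "s < n" "u < n" using D(2) mem by blast+
  have s_pos: "(i, j, k) \<in> {(a, b, s), (a', b', s)}" if "?s i j k > 0" for i j k
    using square_positive(2)[OF ne that] by blast
  have u_neg: "(i, j, k) \<in> {(a, b', u), (a', b, u)}" if "?u i j k < 0" for i j k
    using square_negative(2)[OF ne that] by blast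
  have ge: "w i j k \<ge> - of_bool ((i, j, k) \<in> L)" for i j k
  proof -
    have "\<not> (?s i j k > 0 \<and> ?u i j k < 0)"
      using s_pos[of i j k] u_neg[of i j k] \<open>s \<noteq> u\<close> by blast
    moreover have "?s i j k > 0 \<or> ?u i j k < 0 \<longrightarrow> (i, j, k) \<in> L"
      using s_pos[of i j k] u_neg[of i j k] mem by blast
    moreover have "?s i j k \<le> 1" "?u i j k \<ge> -1"
      using square_positive(1)[OF ne] square_negative(1)[OF ne] by blast+
    ultimately show ?thesis
      by (cases "(i, j, k) \<in> L") (auto simp: w_def)
  qed
  define M where "M = {(i, j, k). i < n \<and> j < n \<and> k < n \<and> of_bool ((i, j, k) \<in> L) + w i j k \<noteq> 0}"
  have "latin_square n M"
    unfolding M_def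
    by (rule latin_square_add_trade[OF L _ _ _ ge])
      (simp_all only: w_def sum_subtractf sum_square lt diff_self)
  moreover have "L - {(a, b, s), (a', b', s), (a, b', u), (a', b, u)} \<subseteq> M"
  proof
    fix e assume e: "e \<in> L - {(a, b, s), (a', b', s), (a, b', u), (a', b, u)}"
    obtain i j k where ijk: "e = (i, j, k)" by (metis prod_cases3)
    have "\<not> ?s i j k > 0" "\<not> ?u i j k < 0" using s_pos[of i j k] u_neg[of i j k] e ijk by blast+
    moreover have "i < n" "j < n" "k < n" using D(2)[of i j k] e ijk by blast+
    ultimately show "e \<in> M" using e by (simp add: ijk M_def w_def)
  qed
  moreover have "(a, b, s) \<notin> M"
    using ne \<open>s \<noteq> u\<close> mem(1) by (simp add: M_def w_def square_def diff_def)
  ultimately show ?thesis using mem(1) by blast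
qed

text \<open>
  In the square \<open>cyclic m\<close> the triple \<open>(a, b, c)\<close> is traded, with \<open>p + q + c + 1 = m\<close>, for
  \<open>(p, b, c)\<close>, \<open>(a, q, c)\<close> and a Euclidean trade on the rectangle \<open>[p, a] \<times> [q, b]\<close>. Such \<open>p\<close>, \<open>q\<close>
  with the rectangle wide enough to meet \<open>triangle m\<close> in no further cell exist if \<open>c\<close> is large.
\<close>

lemma triangle_trade_large_symbol:
  assumes abc: "(a, b, c) \<in> triangle m" and c: "m \<le> 2 * c"
  shows "\<exists>M. latin_square m M \<and> triangle m - {(a, b, c)} \<subseteq> M \<and> M \<noteq> cyclic m"
proof -
  from abc have lt: "a < m" "b < m" "c < m" and sum: "a + b + c + 1 = 2 * m"
    by (auto simp: triangle_def)
  define s where "s = m - 1 - c"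
  \<comment> \<open>As \<open>a + b = m + s\<close>, the last inequality for the rectangle splits
    into \<open>p + b < m\<close> and \<open>2 * s < p + b\<close>. The least \<open>p\<close> for
    the second is taken, with truncation to 0 if \<open>b\<close> alone is large enough; the first
    then follows from \<open>m \<le> 2 * c\<close>.\<close>
  define p where "p = 2 * s + 1 - b"
  define q where "q = s - p"
  have s: "s + c + 1 = m" using lt by (simp add: s_def)
  have pq: "p < a" "q < b" "p + q + c + 1 = m" "a + b < m + min (a - p) (b - q)"
    using lt sum s c unfolding q_def p_def by linarith+
  obtain w where w: "rectangle_trade m p a q b w"
    using rectangle_trade_exists[OF pq(1,2) lt(1,2) pq(4)] by blast
  let ?q = "square c p a q b"
  define v where "v i j k = w i j k - ?q i j k" for i j k
  have ne: "p \<noteq> a" "q \<noteq> b" using pq by auto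
  have w_neg: "i + j + k + 1 = m \<and> (i, j) \<noteq> (p, q) \<and> (i, j) \<noteq> (a, b)" if "w i j k < 0" for i j k
    using w that unfolding rectangle_trade_def by blast
  have sw: "(\<Sum>k<m. w i j k) = diff p a i * diff q b j"
    "(\<Sum>j<m. w i j k) = 0" "(\<Sum>i<m. w i j k) = 0" "w i j k \<ge> -1" for i j k
    using w unfolding rectangle_trade_def by blast+
  have m: "p < m" "q < m" using pq lt by auto
  note sq = sum_square[OF m(1) lt(1) m(2) lt(2,3)]
  note q_pos = square_positive[OF ne, of c]
  have ge: "v i j k \<ge> - of_bool ((i, j, k) \<in> cyclic m)" if ijk: "i < m" "j < m" "k < m" for i j k
  proof -
    have "w i j k < 0 \<or> ?q i j k > 0 \<longrightarrow> (i, j, k) \<in> cyclic m"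
      using w_neg[of i j k] q_pos(2)[of i j k] ijk pq(3) sum by (auto simp: cyclic_def)
    \<comment> \<open>\<open>?q\<close> is positive only in the two corner cells that
      \<open>rectangle_trade\<close> exempts.\<close>
    moreover have "\<not> (w i j k < 0 \<and> ?q i j k > 0)"
      using w_neg[of i j k] q_pos(2)[of i j k] by auto
    ultimately show ?thesis
      using sw(4)[of i j k] q_pos(1)[of i j k] by (cases "(i, j, k) \<in> cyclic m") (auto simp: v_def)
  qed
  define M where "M = {(i, j, k). i < m \<and> j < m \<and> k < m \<and>
    of_bool ((i, j, k) \<in> cyclic m) + v i j k \<noteq> 0}"
  have M: "latin_square m M"
    unfolding M_def
    by (rule latin_square_add_trade[OF latin_square_cyclic _ _ _ ge])
      (simp_all only: v_def sum_subtractf sw sq diff_self)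
  have "triangle m - {(a, b, c)} \<subseteq> M"
  proof
    fix e assume e: "e \<in> triangle m - {(a, b, c)}"
    obtain i j k where e': "e = (i, j, k)" by (cases e)
    with e have ijk: "i < m" "j < m" "k < m" "i + j + k + 1 = 2 * m" "(i, j, k) \<noteq> (a, b, c)"
      by (auto simp: triangle_def)
    then have "\<not> w i j k < 0" using w_neg[of i j k] by auto
    moreover have "\<not> ?q i j k > 0" using q_pos(2)[of i j k] ijk pq(3) by auto
    moreover have "(i, j, k) \<in> cyclic m" using ijk by (simp add: cyclic_def)
    ultimately show "e \<in> M" using ijk by (simp add: M_def e' v_def)
  qed
  moreover have "M \<noteq> cyclic m"
  proof -
    have "\<not> w p b c < 0" using w_neg[of p b c] pq by auto
    moreover have "?q p b c = -1" using pq by (simp add: square_def diff_def)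
    ultimately have "(p, b, c) \<in> M" using m lt by (simp add: M_def v_def)
    moreover have "(p, b, c) \<notin> cyclic m" using pq sum by (auto simp: cyclic_def)
    ultimately show ?thesis by blast
  qed
  ultimately show ?thesis using M by blast
qed

lemma latin_square_rotate:
  assumes "latin_square m M"
  shows "latin_square m {(i, j, k). (j, k, i) \<in> M}"
proof (rule latin_squareI)
  note D = latin_squareD[OF assms]
  have "{(i, j, k). (j, k, i) \<in> M} \<subseteq> {..<m} \<times> {..<m} \<times> {..<m}" using D(2) by auto
  then show "partial_latin_square m {(i, j, k). (j, k, i) \<in> M}"
    unfolding partial_latin_square_def using D(3-5) by blast
  show "\<exists>k. (i, j, k) \<in> {(i, j, k). (j, k, i) \<in> M}" if "i < m" "j < m" for i j
    using latin_square_cover(2)[OF assms that(2,1)] by auto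
qed

text \<open>Rotating the coordinates preserves both \<open>cyclic m\<close> and
  \<open>triangle m\<close>, so the large coordinate can be moved into the symbol position.\<close>

lemma triangle_trade_rotate:
  assumes "\<exists>M. latin_square m M \<and> triangle m - {(b, c, a)} \<subseteq> M \<and> M \<noteq> cyclic m"
  shows "\<exists>M. latin_square m M \<and> triangle m - {(a, b, c)} \<subseteq> M \<and> M \<noteq> cyclic m"
proof -
  from assms obtain N where N: "latin_square m N" "triangle m - {(b, c, a)} \<subseteq> N" "N \<noteq> cyclic m"
    by blast
  let ?M = "{(i, j, k). (j, k, i) \<in> N}"
  have rot: "(j, k, i) \<in> triangle m \<longleftrightarrow> (i, j, k) \<in> triangle m"
    "(j, k, i) \<in> cyclic m \<longleftrightarrow> (i, j, k) \<in> cyclic m" for i j k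
    by (auto simp: triangle_def cyclic_def)
  have "triangle m - {(a, b, c)} \<subseteq> ?M" using N(2) rot(1) by blast
  moreover have "?M \<noteq> cyclic m"
  proof
    assume eq: "?M = cyclic m"
    have "(j, k, i) \<in> N \<longleftrightarrow> (j, k, i) \<in> cyclic m" for i j k
      using eq rot(2)[of j k i] by blast
    then show False using N(3) by auto
  qed
  ultimately show ?thesis using latin_square_rotate[OF N(1)] by blast
qed

lemma critical_set_cyclic:
  assumes "m > 0"
  shows "critical_set m (cyclic m) (triangle m)"
proof (rule critical_setI)
  show "latin_square m (cyclic m)" by (rule latin_square_cyclic)
  show "cyclic m \<subseteq> M" if "latin_square m M" "triangle m \<subseteq> M" for M
    using that by (rule triangle_determines_cyclic)
  have "triangle m \<subseteq> cyclic m" unfolding triangle_def cyclic_def by blast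
  moreover have "(0, 0, m - 1) \<in> cyclic m" "(0, 0, m - 1) \<notin> triangle m"
    using assms by (simp_all add: cyclic_def triangle_def)
  ultimately show "triangle m \<subset> cyclic m" by blast
  fix t assume "t \<in> triangle m"
  then obtain a b c where t: "t = (a, b, c)" and abc: "(a, b, c) \<in> triangle m" by (metis prod_cases3)
  then have ineq: "a < m" "b < m" "c < m" "a + b + c + 1 = 2 * m" by (simp_all add: triangle_def)
  then have rot: "(b, c, a) \<in> triangle m" "(c, a, b) \<in> triangle m" by (simp_all add: triangle_def)
  \<comment> \<open>If all three coordinates doubled were below \<open>m\<close>, then
    \<open>4 * m - 2\<close> would be at most \<open>3 * m - 3\<close>.\<close>
  from ineq consider "m \<le> 2 * c" | "m \<le> 2 * a" | "m \<le> 2 * b" by linarith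
  then show "\<exists>M. latin_square m M \<and> triangle m - {t} \<subseteq> M \<and> M \<noteq> cyclic m"
  proof cases
    case 1
    show ?thesis unfolding t by (rule triangle_trade_large_symbol[OF abc 1])
  next
    case 2
    show ?thesis
      unfolding t by (rule triangle_trade_rotate[OF triangle_trade_large_symbol[OF rot(1) 2]])
  next
    case 3
    show ?thesis
      unfolding t
      by (rule triangle_trade_rotate[OF triangle_trade_rotate[OF triangle_trade_large_symbol[OF rot(2) 3]]])
  qed
qed

section \<open>Size of the triangle\<close>

lemma card_isotope:
  assumes Q: "Q \<subseteq> {..<m} \<times> {..<m} \<times> {..<m}"
    and f: "inverses m f f'" and g: "inverses m g g'" and h: "inverses m h h'"
  shows "card (isotope m f g h Q) = card Q"
proof -
  have fin: "finite Q" using Q by (rule finite_subset) auto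
  have "bij_betw (\<lambda>(i, j, k). (f i, g j, h k)) (isotope m f g h Q) Q"
  proof (rule bij_betw_byWitness[where f' = "\<lambda>(i, j, k). (f' i, g' j, h' k)"])
    show "\<forall>a\<in>isotope m f g h Q. (\<lambda>(i, j, k). (f' i, g' j, h' k)) ((\<lambda>(i, j, k). (f i, g j, h k)) a) = a"
      using f g h by (auto simp: isotope_def inverses_def)
    show "\<forall>a\<in>Q. (\<lambda>(i, j, k). (f i, g j, h k)) ((\<lambda>(i, j, k). (f' i, g' j, h' k)) a) = a"
      using f g h Q by (auto simp: inverses_def)
    show "(\<lambda>(i, j, k). (f i, g j, h k)) ` isotope m f g h Q \<subseteq> Q"
      by (auto simp: isotope_def)
    show "(\<lambda>(i, j, k). (f' i, g' j, h' k)) ` Q \<subseteq> isotope m f g h Q"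
    proof
      fix e assume "e \<in> (\<lambda>(i, j, k). (f' i, g' j, h' k)) ` Q"
      then obtain i j k where e: "(i, j, k) \<in> Q" "e = (f' i, g' j, h' k)" by auto
      moreover from e Q have "i < m" "j < m" "k < m" by auto
      ultimately show "e \<in> isotope m f g h Q"
        using f g h by (simp add: isotope_def inverses_def)
    qed
  qed
  then show ?thesis by (rule bij_betw_same_card)
qed

text \<open>Row \<open>i\<close> of the triangle has exactly \<open>i\<close> entries. The additive
  form avoids division and truncated subtraction.\<close>

lemma card_triangle: "2 * card (triangle m) + m = m\<^sup>2"
proof -
  let ?S = "SIGMA i:{..<m}. {m - i..<m}"
  have "bij_betw (\<lambda>(i, j, k). (i, j)) (triangle m) ?S"
    by (rule bij_betw_byWitness[where f' = "\<lambda>(i, j). (i, j, 2 * m - 1 - i - j)"])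
      (auto simp: triangle_def)
  then have "card (triangle m) = card ?S" by (rule bij_betw_same_card)
  also have "\<dots> = (\<Sum>i<m. card {m - i..<m})" by simp
  also have "\<dots> = (\<Sum>i<m. i)" by (intro sum.cong) auto
  finally have "card (triangle m) = (\<Sum>i<m. i)" .
  moreover have "2 * (\<Sum>i<m. i) + m = m\<^sup>2"
    by (induction m) (auto simp: power2_eq_square)
  ultimately show ?thesis by simp
qed

section \<open>The blocks as isotopes of the cyclic square\<close>

lemma nat_diff_mod:
  assumes "i < m" "j < m"
  shows "nat ((int i - int j) mod int m) = (if j \<le> i then i - j else m + i - j)"
proof (cases "j \<le> i")
  case True
  have "(int i - int j) mod int m = int ((i - j) mod m)"
    by (simp only: of_nat_diff[OF True] zmod_int)
  then show ?thesis using True assms by simp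
next
  case False
  have "int (m + i) - int j = int i - int j + int m" by simp
  then have "(int i - int j) mod int m = (int (m + i) - int j) mod int m"
    by (simp only: mod_add_self2)
  also have "\<dots> = int ((m + i - j) mod m)"
    using assms by (simp only: of_nat_diff[of j "m + i"] zmod_int trans_le_add1 less_imp_le)
  finally show ?thesis using False assms by simp
qed

text \<open>Two linear cases in place of the modular formula leave later membership claims to linear
  arithmetic.\<close>

lemma mem_A: "(i, j, k) \<in> A m \<longleftrightarrow> i < m \<and> j < m \<and> k < m \<and> (i = j + k \<or> i + m = j + k)"
proof (cases "i < m \<and> j < m")
  case True
  then show ?thesis unfolding A_def by (auto simp: nat_diff_mod)
qed (auto simp: A_def)

lemma mem_AT: "(i, j, k) \<in> AT m \<longleftrightarrow> i < m \<and> j < m \<and> k < m \<and> (j = i + k \<or> j + m = i + k)"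
proof (cases "i < m \<and> j < m")
  case True
  then show ?thesis unfolding AT_def by (auto simp: nat_diff_mod)
qed (auto simp: AT_def)

lemma mem_B: "(i, j, k) \<in> B m \<longleftrightarrow> i < m \<and> j < m \<and> k < m \<and> (i + j = k \<or> i + j = m + k)"
proof (cases "i < m \<and> j < m")
  case True
  have "(i + j) mod m = (if i + j < m then i + j else i + j - m)"
    using True by (simp add: mod_if, linarith)
  then show ?thesis using True unfolding B_def by auto
qed (auto simp: B_def)

lemmas mem_blocks = mem_A mem_AT mem_B

lemma array_eqI: "(\<And>i j k. (i, j, k) \<in> X \<longleftrightarrow> (i, j, k) \<in> Y) \<Longrightarrow> X = (Y :: array)"
  by auto

lemma mem_isotope: "(i, j, k) \<in> isotope m f g h Q \<longleftrightarrow> i < m \<and> j < m \<and> k < m \<and> (f i, g j, h k) \<in> Q"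
  by (simp add: isotope_def)

lemma mem_cyclic: "(i, j, k) \<in> cyclic m \<longleftrightarrow>
    i < m \<and> j < m \<and> k < m \<and> (i + j + k + 1 = m \<or> i + j + k + 1 = 2 * m)"
  by (simp add: cyclic_def)

lemma mem_triangle: "(i, j, k) \<in> triangle m \<longleftrightarrow> i < m \<and> j < m \<and> k < m \<and> i + j + k + 1 = 2 * m"
  by (simp add: triangle_def)

lemma mem_partial:
  "(i, j, k) \<in> H m Q \<longleftrightarrow> (i, j, k) \<in> Q \<and> 1 \<le> j \<and> j \<le> i \<and> i \<le> m - 1"
  "(i, j, k) \<in> J m Q \<longleftrightarrow> (i, j, k) \<in> Q \<and> 1 \<le> i \<and> i \<le> j \<and> j \<le> m - 1"
  "(i, j, k) \<in> G m Q \<longleftrightarrow> (i, j, k) \<in> Q \<and> i < m \<and> j < m \<and> m \<le> i + j \<and> i + j \<le> 2 * m - 2"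
  by (simp_all add: H_def J_def G_def)

lemma neg_cases: "i < m \<Longrightarrow> i = 0 \<and> neg m i = 0 \<or> 0 < i \<and> neg m i + i = m"
  by (auto simp: neg_def)

lemma reflect_add: "k < m \<Longrightarrow> reflect m k + k + 1 = m"
  by (auto simp: reflect_def)

text \<open>Each symbol is a signed sum of row and column modulo \<open>m\<close>; negations even
  out the signs and \<open>reflect\<close> supplies the constant \<open>-1\<close>.
  \<open>A m\<close> occurs twice because its triangles \<open>H\<close> and \<open>J\<close> need
  different changes of coordinates.\<close>

lemma mem_blocks_transform:
  assumes "i < m" "j < m" "k < m"
  shows "(i, j, k) \<in> A m \<longleftrightarrow> (i, neg m j, reflect m k) \<in> cyclic m"
    and "(i, j, k) \<in> H m (A m) \<longleftrightarrow> (i, neg m j, reflect m k) \<in> triangle m"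
    and "(i, j, k) \<in> A m \<longleftrightarrow> (neg m i, j, reflect m (neg m k)) \<in> cyclic m"
    and "(i, j, k) \<in> J m (A m) \<longleftrightarrow> (neg m i, j, reflect m (neg m k)) \<in> triangle m"
    and "(i, j, k) \<in> AT m \<longleftrightarrow> (i, neg m j, reflect m (neg m k)) \<in> cyclic m"
    and "(i, j, k) \<in> H m (AT m) \<longleftrightarrow> (i, neg m j, reflect m (neg m k)) \<in> triangle m"
    and "(i, j, k) \<in> B m \<longleftrightarrow> (i, j, reflect m k) \<in> cyclic m"
    and "(i, j, k) \<in> G m (B m) \<longleftrightarrow> (i, j, reflect m k) \<in> triangle m"
proof -
  show "(i, j, k) \<in> A m \<longleftrightarrow> (i, neg m j, reflect m k) \<in> cyclic m"
    using assms neg_cases[of j m] reflect_add[of k m]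
    unfolding mem_blocks mem_partial mem_cyclic by linarith
  show "(i, j, k) \<in> H m (A m) \<longleftrightarrow> (i, neg m j, reflect m k) \<in> triangle m"
    using assms neg_cases[of j m] reflect_add[of k m]
    unfolding mem_blocks mem_partial mem_triangle by linarith
  show "(i, j, k) \<in> A m \<longleftrightarrow> (neg m i, j, reflect m (neg m k)) \<in> cyclic m"
    using assms neg_cases[of i m] neg_cases[of k m] reflect_add[of "neg m k" m] reflect_involution[of k m]
    unfolding mem_blocks mem_partial mem_cyclic by linarith
  show "(i, j, k) \<in> J m (A m) \<longleftrightarrow> (neg m i, j, reflect m (neg m k)) \<in> triangle m"
    using assms neg_cases[of i m] neg_cases[of k m] reflect_add[of "neg m k" m] reflect_involution[of k m]
    unfolding mem_blocks mem_partial mem_triangle by linarith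
  show "(i, j, k) \<in> AT m \<longleftrightarrow> (i, neg m j, reflect m (neg m k)) \<in> cyclic m"
    using assms neg_cases[of j m] neg_cases[of k m] reflect_add[of "neg m k" m] reflect_involution[of k m]
    unfolding mem_blocks mem_partial mem_cyclic by linarith
  show "(i, j, k) \<in> H m (AT m) \<longleftrightarrow> (i, neg m j, reflect m (neg m k)) \<in> triangle m"
    using assms neg_cases[of j m] neg_cases[of k m] reflect_add[of "neg m k" m] reflect_involution[of k m]
    unfolding mem_blocks mem_partial mem_triangle by linarith
  show "(i, j, k) \<in> B m \<longleftrightarrow> (i, j, reflect m k) \<in> cyclic m"
    using assms reflect_add[of k m]
    unfolding mem_blocks mem_partial mem_cyclic by linarith
  show "(i, j, k) \<in> G m (B m) \<longleftrightarrow> (i, j, reflect m k) \<in> triangle m"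
    using assms reflect_add[of k m]
    unfolding mem_blocks mem_partial mem_triangle by linarith
qed

lemma blocks_eq_isotope:
  "A m = isotope m id (neg m) (reflect m) (cyclic m)"
  "A m = isotope m (neg m) id (reflect m \<circ> neg m) (cyclic m)"
  "AT m = isotope m id (neg m) (reflect m \<circ> neg m) (cyclic m)"
  "B m = isotope m id id (reflect m) (cyclic m)"
  by (rule array_eqI, metis (lifting) mem_isotope mem_blocks_transform(1,3,5,7) mem_blocks mem_partial comp_apply id_apply)+

lemma partial_blocks_eq_isotope:
  "H m (A m) = isotope m id (neg m) (reflect m) (triangle m)"
  "J m (A m) = isotope m (neg m) id (reflect m \<circ> neg m) (triangle m)"
  "H m (AT m) = isotope m id (neg m) (reflect m \<circ> neg m) (triangle m)"
  "G m (B m) = isotope m id id (reflect m) (triangle m)"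
  by (rule array_eqI, metis (lifting) mem_isotope mem_blocks_transform(2,4,6,8) mem_blocks mem_partial comp_apply id_apply)+

lemma critical_set_blocks:
  assumes "m > 0"
  shows "critical_set m (A m) (H m (A m))" "critical_set m (A m) (J m (A m))"
    "critical_set m (AT m) (H m (AT m))" "critical_set m (B m) (G m (B m))"
proof -
  note * = critical_set_isotope[OF critical_set_cyclic[OF assms]]
  show "critical_set m (A m) (H m (A m))"
    using *[OF inverses_inst(1,2,3)] by (simp only: blocks_eq_isotope(1)[symmetric] partial_blocks_eq_isotope(1)[symmetric])
  show "critical_set m (A m) (J m (A m))"
    using *[OF inverses_inst(2,1,4)] by (simp only: blocks_eq_isotope(2)[symmetric] partial_blocks_eq_isotope(2)[symmetric])
  show "critical_set m (AT m) (H m (AT m))"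
    using *[OF inverses_inst(1,2,4)] by (simp only: blocks_eq_isotope(3)[symmetric] partial_blocks_eq_isotope(3)[symmetric])
  show "critical_set m (B m) (G m (B m))"
    using *[OF inverses_inst(1,1,3)] by (simp only: blocks_eq_isotope(4)[symmetric] partial_blocks_eq_isotope(4)[symmetric])
qed

section \<open>Assembling a square from sixteen blocks\<close>

text \<open>Addition table of the Klein four-group, the pattern of the symbol groups in
  \<open>L'\<close>.\<close>

definition xor4 :: "nat \<Rightarrow> nat \<Rightarrow> nat" where
  "xor4 x y = [[0, 1, 2, 3], [1, 0, 3, 2], [2, 3, 0, 1], [3, 2, 1, 0]] ! x ! y"

lemma less_4: "x < 4 \<longleftrightarrow> x = 0 \<or> x = 1 \<or> x = 2 \<or> x = (3 :: nat)"
  by auto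

lemma lessThan_4: "{..<4 :: nat} = {0, 1, 2, 3}"
  using less_4 by (simp add: lessThan_def set_eq_iff)

lemma xor4_simps:
  "xor4 0 0 = 0" "xor4 0 1 = 1" "xor4 0 2 = 2" "xor4 0 3 = 3"
  "xor4 1 0 = 1" "xor4 1 1 = 0" "xor4 1 2 = 3" "xor4 1 3 = 2"
  "xor4 2 0 = 2" "xor4 2 1 = 3" "xor4 2 2 = 0" "xor4 2 3 = 1"
  "xor4 3 0 = 3" "xor4 3 1 = 2" "xor4 3 2 = 1" "xor4 3 3 = 0"
  by (simp_all add: xor4_def numeral_2_eq_2 numeral_3_eq_3)

lemma xor4_less: "x < 4 \<Longrightarrow> y < 4 \<Longrightarrow> xor4 x y < 4"
  unfolding less_4 by (elim disjE; simp only: xor4_simps; simp)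

lemma xor4_inj:
  assumes "x < 4" "y < 4" "z < 4"
  shows "xor4 x y = xor4 x z \<Longrightarrow> y = z" "xor4 y x = xor4 z x \<Longrightarrow> y = z"
proof -
  have "\<forall>x\<in>{..<4}. \<forall>y\<in>{..<4}. \<forall>z\<in>{..<4}.
      (xor4 x y = xor4 x z \<longrightarrow> y = z) \<and> (xor4 y x = xor4 z x \<longrightarrow> y = z)"
    unfolding lessThan_4 ball_simps xor4_simps by simp
  then show "xor4 x y = xor4 x z \<Longrightarrow> y = z" "xor4 y x = xor4 z x \<Longrightarrow> y = z"
    using assms by (meson lessThan_iff)+
qed

lemma block_index_inj:
  fixes m :: nat
  assumes "i < m" "i' < m" "x * m + i = x' * m + i'"
  shows "x = x'" "i = i'"
proof -
  have div: "(y * m + j) div m = y" if "j < m" for y j using that by simp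
  show "x = x'" using div[OF assms(1), of x] div[OF assms(2), of x'] assms(3) by metis
  then show "i = i'" using assms(3) by simp
qed

lemma block_index_less:
  fixes m :: nat
  assumes "x < 4" "i < m"
  shows "x * m + i < 4 * m"
proof -
  have "x * m + i < (x + 1) * m" using assms by simp
  also have "\<dots> \<le> 4 * m" using assms by (intro mult_le_mono1) simp
  finally show ?thesis .
qed

lemma block_index_lessD:
  fixes m :: nat
  assumes "x * m + i < 4 * m"
  shows "x < 4"
proof (rule ccontr)
  assume "\<not> ?thesis"
  then have "4 * m \<le> x * m" by (intro mult_le_mono1) simp
  then show False using assms by linarith
qed

lemma block_index_exhaust:
  fixes m :: nat
  assumes "n < 4 * m"
  obtains x i where "x < 4" "i < m" "n = x * m + i"
proof
  have "m > 0" using assms by (cases m) auto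
  then show "n mod m < m" by simp
  show "n = (n div m) * m + n mod m" by simp
  show "n div m < 4" using assms by (simp add: less_mult_imp_div_less)
qed

text \<open>A common form for \<open>L'\<close>, for \<open>P\<close> and for \<open>L'\<close> with
  one block exchanged.\<close>

definition assemble :: "nat \<Rightarrow> (nat \<Rightarrow> nat \<Rightarrow> array) \<Rightarrow> array" where
  "assemble m Q = (\<Union>x\<in>{..<4}. \<Union>y\<in>{..<4}. S m (Q x y) x y (xor4 x y))"

lemma assembleI:
  "x < 4 \<Longrightarrow> y < 4 \<Longrightarrow> (i, j, k) \<in> Q x y \<Longrightarrow>
    (x * m + i, y * m + j, xor4 x y * m + k) \<in> assemble m Q"
  unfolding assemble_def S_def by blast

lemma assembleE:
  assumes "e \<in> assemble m Q"
  obtains x y i j k where "x < 4" "y < 4" "(i, j, k) \<in> Q x y"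
    "e = (x * m + i, y * m + j, xor4 x y * m + k)"
  using assms unfolding assemble_def S_def by blast

lemma mem_assemble:
  assumes sub: "\<And>x y. x < 4 \<Longrightarrow> y < 4 \<Longrightarrow> Q x y \<subseteq> {..<m} \<times> {..<m} \<times> {..<m}"
    and lt: "x < 4" "y < 4" "i < m" "j < m" "k < m"
  shows "(x * m + i, y * m + j, xor4 x y * m + k) \<in> assemble m Q \<longleftrightarrow> (i, j, k) \<in> Q x y"
proof
  assume "(x * m + i, y * m + j, xor4 x y * m + k) \<in> assemble m Q"
  then obtain x' y' i' j' k' where *: "x' < 4" "y' < 4" "(i', j', k') \<in> Q x' y'"
    "(x * m + i, y * m + j, xor4 x y * m + k) = (x' * m + i', y' * m + j', xor4 x' y' * m + k')"
    by (rule assembleE)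
  then have eq: "x * m + i = x' * m + i'" "y * m + j = y' * m + j'" "xor4 x y * m + k = xor4 x' y' * m + k'"
    by simp_all
  have "i' < m" "j' < m" "k' < m" using sub[OF *(1,2)] *(3) by blast+
  then show "(i, j, k) \<in> Q x y"
    using block_index_inj[OF _ _ eq(1)] block_index_inj[OF _ _ eq(2)] block_index_inj[OF _ _ eq(3)] lt *(3)
    by simp
qed (rule assembleI[OF lt(1,2)])

lemma latin_square_assemble:
  assumes L: "\<And>x y. x < 4 \<Longrightarrow> y < 4 \<Longrightarrow> latin_square m (Q x y)"
  shows "latin_square (4 * m) (assemble m Q)"
proof (rule latin_squareI)
  let ?M = "assemble m Q"
  note D = latin_squareD[OF L]
  have decode: "\<exists>x<4. \<exists>y<4. \<exists>i<m. \<exists>j<m. \<exists>k<m. (i, j, k) \<in> Q x y \<and>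
      X = x * m + i \<and> Y = y * m + j \<and> Z = xor4 x y * m + k" if "(X, Y, Z) \<in> ?M" for X Y Z
  proof -
    from that obtain x y i j k where *: "x < 4" "y < 4" "(i, j, k) \<in> Q x y"
      "(X, Y, Z) = (x * m + i, y * m + j, xor4 x y * m + k)" by (rule assembleE)
    with D(2)[OF *(1,2,3)] show ?thesis by blast
  qed
  have "?M \<subseteq> {..<4 * m} \<times> {..<4 * m} \<times> {..<4 * m}"
  proof
    fix e assume "e \<in> ?M"
    then obtain x y i j k where *: "x < 4" "y < 4" "(i, j, k) \<in> Q x y"
      "e = (x * m + i, y * m + j, xor4 x y * m + k)" by (rule assembleE)
    then show "e \<in> {..<4 * m} \<times> {..<4 * m} \<times> {..<4 * m}"
      using D(2)[OF *(1,2,3)] xor4_less[OF *(1,2)] by (simp add: block_index_less)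
  qed
  moreover have "Z = Z'" if "(X, Y, Z) \<in> ?M" "(X, Y, Z') \<in> ?M" for X Y Z Z'
    using decode[OF that(1)] decode[OF that(2)]
    by (elim exE conjE) (metis D(3) block_index_inj)
  moreover have "Y = Y'" if "(X, Y, Z) \<in> ?M" "(X, Y', Z) \<in> ?M" for X Y Y' Z
    using decode[OF that(1)] decode[OF that(2)]
    by (elim exE conjE) (metis D(4) block_index_inj xor4_inj(1))
  moreover have "X = X'" if "(X, Y, Z) \<in> ?M" "(X', Y, Z) \<in> ?M" for X X' Y Z
    using decode[OF that(1)] decode[OF that(2)]
    by (elim exE conjE) (metis D(5) block_index_inj xor4_inj(2))
  ultimately show "partial_latin_square (4 * m) ?M"
    unfolding partial_latin_square_def by blast
  fix X Y assume X: "X < 4 * m" and Y: "Y < 4 * m"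
  obtain x i where x: "x < 4" "i < m" "X = x * m + i" using X by (rule block_index_exhaust)
  obtain y j where y: "y < 4" "j < m" "Y = y * m + j" using Y by (rule block_index_exhaust)
  obtain k where "(i, j, k) \<in> Q x y"
    using latin_square_cover(1)[OF L[OF x(1) y(1)] x(2) y(2)] by blast
  then show "\<exists>Z. (X, Y, Z) \<in> ?M" using assembleI[OF x(1) y(1)] x(3) y(3) by blast
qed

lemma card_assemble:
  assumes sub: "\<And>x y. x < 4 \<Longrightarrow> y < 4 \<Longrightarrow> Q x y \<subseteq> {..<m} \<times> {..<m} \<times> {..<m}"
  shows "card (assemble m Q) = (\<Sum>x<4. \<Sum>y<4. card (Q x y))"
proof -
  let ?I = "SIGMA p:{..<4} \<times> {..<4}. Q (fst p) (snd p)"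
  let ?f = "\<lambda>((x, y), (i, j, k)). (x * m + i, y * m + j, xor4 x y * m + k)"
  have fin: "finite (Q x y)" if "x < 4" "y < 4" for x y
    using sub[OF that] by (rule finite_subset) auto
  have "bij_betw ?f ?I (assemble m Q)"
    unfolding bij_betw_def
  proof
    show "inj_on ?f ?I"
    proof (rule inj_onI)
      fix p q assume p: "p \<in> ?I" and q: "q \<in> ?I" and eq: "?f p = ?f q"
      obtain x y i j k where p': "p = ((x, y), (i, j, k))" by (metis prod_cases3 surj_pair)
      obtain x' y' i' j' k' where q': "q = ((x', y'), (i', j', k'))" by (metis prod_cases3 surj_pair)
      have x: "x < 4" "y < 4" "(i, j, k) \<in> Q x y" using p p' by simp_all
      have x': "x' < 4" "y' < 4" "(i', j', k') \<in> Q x' y'" using q q' by simp_all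
      have lt: "i < m" "j < m" "k < m" using sub[OF x(1,2)] x(3) by blast+
      have lt': "i' < m" "j' < m" "k' < m" using sub[OF x'(1,2)] x'(3) by blast+
      have e: "x * m + i = x' * m + i'" "y * m + j = y' * m + j'" "xor4 x y * m + k = xor4 x' y' * m + k'"
        using eq p' q' by simp_all
      show "p = q"
        unfolding p' q'
        using block_index_inj[OF lt(1) lt'(1) e(1)] block_index_inj[OF lt(2) lt'(2) e(2)]
          block_index_inj[OF lt(3) lt'(3) e(3)] by simp
    qed
    show "?f ` ?I = assemble m Q"
    proof
      show "?f ` ?I \<subseteq> assemble m Q"
      proof
        fix e assume "e \<in> ?f ` ?I"
        then obtain p where p: "p \<in> ?I" "e = ?f p" by blast
        obtain x y i j k where p': "p = ((x, y), (i, j, k))" by (metis prod_cases3 surj_pair)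
        then show "e \<in> assemble m Q" using p assembleI[of x y i j k Q m] by simp
      qed
      show "assemble m Q \<subseteq> ?f ` ?I"
      proof
        fix e assume "e \<in> assemble m Q"
        then obtain x y i j k where *: "x < 4" "y < 4" "(i, j, k) \<in> Q x y"
          "e = (x * m + i, y * m + j, xor4 x y * m + k)" by (rule assembleE)
        show "e \<in> ?f ` ?I"
          using * by (intro image_eqI[of _ _ "((x, y), (i, j, k))"]) simp_all
      qed
    qed
  qed
  then have "card (assemble m Q) = card ?I" by (rule bij_betw_same_card[symmetric])
  also have "\<dots> = (\<Sum>p\<in>{..<4} \<times> {..<4}. card (Q (fst p) (snd p)))"
    using fin by (intro card_SigmaI) auto
  also have "\<dots> = (\<Sum>x<4. \<Sum>y<4. card (Q x y))"
    by (simp only: sum.cartesian_product case_prod_unfold)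
  finally show ?thesis .
qed

section \<open>Blocks that use a single group of symbols\<close>

definition block_symbol :: "nat \<Rightarrow> array \<Rightarrow> nat \<Rightarrow> nat \<Rightarrow> nat \<Rightarrow> bool" where
  "block_symbol m M x y z \<longleftrightarrow>
    (\<exists>i<m. \<exists>j<m. \<exists>k<m. (x * m + i, y * m + j, z * m + k) \<in> M)"

definition pure :: "nat \<Rightarrow> array \<Rightarrow> nat \<Rightarrow> nat \<Rightarrow> nat \<Rightarrow> bool" where
  "pure m M x y z \<longleftrightarrow> (\<forall>w. block_symbol m M x y w \<longrightarrow> w = z)"

definition block :: "nat \<Rightarrow> array \<Rightarrow> nat \<Rightarrow> nat \<Rightarrow> nat \<Rightarrow> array" where
  "block m M x y z =
    {(i, j, k). i < m \<and> j < m \<and> k < m \<and> (x * m + i, y * m + j, z * m + k) \<in> M}"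

lemma block_symbol_less:
  assumes "latin_square (4 * m) M" "block_symbol m M x y z"
  shows "z < 4"
  using assms(2) latin_squareD(2)[OF assms(1)] block_index_lessD
  unfolding block_symbol_def by blast

lemma latin_square_block:
  assumes M: "latin_square (4 * m) M" and pure: "pure m M x y z" and xy: "x < 4" "y < 4"
  shows "latin_square m (block m M x y z)"
proof (rule latin_squareI)
  note D = latin_squareD[OF M]
  define N where "N = block m M x y z"
  have mem: "i < m \<and> j < m \<and> k < m \<and> (x * m + i, y * m + j, z * m + k) \<in> M" if "(i, j, k) \<in> N" for i j k
    using that by (simp add: N_def block_def)
  have "N \<subseteq> {..<m} \<times> {..<m} \<times> {..<m}" by (auto simp: N_def block_def)
  moreover have "k = k'" if "(i, j, k) \<in> N" "(i, j, k') \<in> N" for i j k k'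
    using mem[OF that(1)] mem[OF that(2)] D(3) by (metis add_left_cancel)
  moreover have "j = j'" if "(i, j, k) \<in> N" "(i, j', k) \<in> N" for i j j' k
    using mem[OF that(1)] mem[OF that(2)] D(4) by (metis add_left_cancel)
  moreover have "i = i'" if "(i, j, k) \<in> N" "(i', j, k) \<in> N" for i i' j k
    using mem[OF that(1)] mem[OF that(2)] D(5) by (metis add_left_cancel)
  ultimately show "partial_latin_square m (block m M x y z)"
    unfolding partial_latin_square_def N_def[symmetric] by blast
  fix i j assume ij: "i < m" "j < m"
  obtain Z where Z: "Z < 4 * m" "(x * m + i, y * m + j, Z) \<in> M"
    using latin_square_cover(1)[OF M block_index_less[OF xy(1) ij(1)] block_index_less[OF xy(2) ij(2)]]
    by blast
  obtain w k where k: "w < 4" "k < m" "Z = w * m + k" using Z(1) by (rule block_index_exhaust)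
  have "block_symbol m M x y w" unfolding block_symbol_def using ij k Z(2) by blast
  then have "w = z" using pure by (simp add: pure_def)
  then have "(i, j, k) \<in> block m M x y z" using ij k Z(2) by (simp add: block_def)
  then show "\<exists>k. (i, j, k) \<in> block m M x y z" ..
qed

text \<open>A pure block is a Latin subsquare, so each of its rows already contains every symbol of
  its group.\<close>

lemma pure_row:
  assumes M: "latin_square (4 * m) M" and pure: "pure m M x y z" and xy: "x < 4" "y < 4"
    and sym: "block_symbol m M x y' z"
  shows "y' = y"
proof -
  from sym obtain i j k where *: "i < m" "j < m" "k < m" "(x * m + i, y' * m + j, z * m + k) \<in> M"
    unfolding block_symbol_def by blast
  obtain j' where "j' < m" "(i, j', k) \<in> block m M x y z"
    using latin_square_cover(2)[OF latin_square_block[OF M pure xy] *(1,3)] by blast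
  then have j': "j' < m" "(x * m + i, y * m + j', z * m + k) \<in> M" by (simp_all add: block_def)
  show ?thesis using block_index_inj(1)[OF *(2) j'(1)] latin_squareD(4)[OF M *(4) j'(2)] by blast
qed

lemma pure_column:
  assumes M: "latin_square (4 * m) M" and pure: "pure m M x y z" and xy: "x < 4" "y < 4"
    and sym: "block_symbol m M x' y z"
  shows "x' = x"
proof -
  from sym obtain i j k where *: "i < m" "j < m" "k < m" "(x' * m + i, y * m + j, z * m + k) \<in> M"
    unfolding block_symbol_def by blast
  obtain i' where "i' < m" "(i', j, k) \<in> block m M x y z"
    using latin_square_cover(3)[OF latin_square_block[OF M pure xy] *(2,3)] by blast
  then have i': "i' < m" "(x * m + i', y * m + j, z * m + k) \<in> M" by (simp_all add: block_def)
  show ?thesis using block_index_inj(1)[OF *(1) i'(1)] latin_squareD(5)[OF M *(4) i'(2)] by blast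
qed

lemma pure_of_filled:
  assumes M: "latin_square (4 * m) M" and Q: "latin_square m Q"
    and sub: "\<And>i j k. (i, j, k) \<in> Q \<Longrightarrow> (x * m + i, y * m + j, z * m + k) \<in> M"
  shows "pure m M x y z"
  unfolding pure_def
proof (intro allI impI)
  fix w assume "block_symbol m M x y w"
  then obtain i j k where *: "i < m" "j < m" "k < m" "(x * m + i, y * m + j, w * m + k) \<in> M"
    unfolding block_symbol_def by blast
  obtain k' where k': "k' < m" "(i, j, k') \<in> Q" using latin_square_cover(1)[OF Q *(1,2)] by blast
  show "w = z" using block_index_inj(1)[OF *(3) k'(1)] latin_squareD(3)[OF M *(4) sub[OF k'(2)]] by blast
qed

lemma pure_all_blocks:
  assumes M: "latin_square (4 * m) M"
    and filled: "pure m M 1 1 0" "pure m M 1 3 2" "pure m M 2 2 0" "pure m M 2 3 1"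
      "pure m M 3 1 2" "pure m M 3 2 1" "pure m M 3 3 0"
    and xy: "x < 4" "y < 4"
  shows "pure m M x y (xor4 x y)"
proof -
  have row: "block_symbol m M x y' z \<longrightarrow> y' = y" if "pure m M x y z" "x < 4" "y < 4" for x y z y'
    using pure_row[OF M that] by blast
  have col: "block_symbol m M x' y z \<longrightarrow> x' = x" if "pure m M x y z" "x < 4" "y < 4" for x y z x'
    using pure_column[OF M that] by blast
  have pureI: "pure m M x y z"
    if "\<And>w. block_symbol m M x y w \<Longrightarrow> w = 0 \<or> w = 1 \<or> w = 2 \<or> w = 3 \<Longrightarrow> w = z" for x y z
    using that block_symbol_less[OF M] unfolding pure_def less_4 by blast
  \<comment> \<open>Blocks \<open>(3, 0)\<close> and \<open>(0, 3)\<close> come first, since the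
    rest of their block row or column is filled. For every later block, too, pure blocks in its row
    and column exclude three of the four groups.\<close>
  have 30: "pure m M 3 0 3"
    using row[OF filled(5), of 0] row[OF filled(6), of 0] row[OF filled(7), of 0]
    by (intro pureI) auto
  have 03: "pure m M 0 3 3"
    using col[OF filled(2), of 0] col[OF filled(4), of 0] col[OF filled(7), of 0]
    by (intro pureI) auto
  have 01: "pure m M 0 1 1"
    using row[OF 03, of 1] col[OF filled(1), of 0] col[OF filled(5), of 0]
    by (intro pureI) auto
  have 02: "pure m M 0 2 2"
    using row[OF 03, of 2] col[OF filled(3), of 0] col[OF filled(6), of 0]
    by (intro pureI) auto
  have 21: "pure m M 2 1 3"
    using col[OF 01, of 2] col[OF filled(1), of 2] col[OF filled(5), of 2]
    by (intro pureI) auto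
  have 12: "pure m M 1 2 3"
    using col[OF 02, of 1] col[OF filled(3), of 1] col[OF filled(6), of 1]
    by (intro pureI) auto
  have 10: "pure m M 1 0 1"
    using row[OF 12, of 0] row[OF filled(1), of 0] row[OF filled(2), of 0]
    by (intro pureI) auto
  have 20: "pure m M 2 0 2"
    using row[OF 21, of 0] row[OF filled(3), of 0] row[OF filled(4), of 0]
    by (intro pureI) auto
  have 00: "pure m M 0 0 0"
    using row[OF 01, of 0] row[OF 02, of 0] row[OF 03, of 0]
    by (intro pureI) auto
  show ?thesis
    using xy unfolding less_4
    by (elim disjE; hypsubst; simp only: xor4_simps filled 30 03 01 02 21 12 10 20 00)
qed

section \<open>The blocks of \<open>L'\<close> and \<open>P\<close>\<close>

definition full_block :: "nat \<Rightarrow> nat \<Rightarrow> nat \<Rightarrow> array" where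
  "full_block m x y =
    [[A m, AT m, AT m, B m], [A m, AT m, B m, AT m], [A m, B m, AT m, AT m], [B m, A m, A m, A m]] ! x ! y"

definition part_block :: "nat \<Rightarrow> nat \<Rightarrow> nat \<Rightarrow> array" where
  "part_block m x y =
    [[H m (A m), H m (AT m), H m (AT m), G m (B m)], [J m (A m), AT m, G m (B m), AT m],
     [J m (A m), G m (B m), AT m, AT m], [G m (B m), A m, A m, A m]] ! x ! y"

lemma full_block_simps:
  "full_block m 0 0 = A m" "full_block m 0 1 = AT m" "full_block m 0 2 = AT m" "full_block m 0 3 = B m"
  "full_block m 1 0 = A m" "full_block m 1 1 = AT m" "full_block m 1 2 = B m" "full_block m 1 3 = AT m"
  "full_block m 2 0 = A m" "full_block m 2 1 = B m" "full_block m 2 2 = AT m" "full_block m 2 3 = AT m"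
  "full_block m 3 0 = B m" "full_block m 3 1 = A m" "full_block m 3 2 = A m" "full_block m 3 3 = A m"
  by (simp_all add: full_block_def numeral_2_eq_2 numeral_3_eq_3)

lemma part_block_simps:
  "part_block m 0 0 = H m (A m)" "part_block m 0 1 = H m (AT m)"
  "part_block m 0 2 = H m (AT m)" "part_block m 0 3 = G m (B m)"
  "part_block m 1 0 = J m (A m)" "part_block m 1 1 = AT m"
  "part_block m 1 2 = G m (B m)" "part_block m 1 3 = AT m"
  "part_block m 2 0 = J m (A m)" "part_block m 2 1 = G m (B m)"
  "part_block m 2 2 = AT m" "part_block m 2 3 = AT m"
  "part_block m 3 0 = G m (B m)" "part_block m 3 1 = A m"
  "part_block m 3 2 = A m" "part_block m 3 3 = A m"
  by (simp_all add: part_block_def numeral_2_eq_2 numeral_3_eq_3)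

lemma L'_eq_assemble: "L' m = assemble m (full_block m)"
  unfolding L'_def assemble_def lessThan_4
  by (simp only: UN_insert UN_empty xor4_simps full_block_simps Un_empty_right Un_assoc)

lemma P_eq_assemble: "P m = assemble m (part_block m)"
  unfolding P_def assemble_def lessThan_4
  by (simp only: UN_insert UN_empty xor4_simps part_block_simps Un_empty_right Un_assoc)

text \<open>
  Every entry of a completely filled block lies in an intercalate whose other three entries are not
  in \<open>P m\<close>; in most cases the entry in the opposite block can be taken in row or column 0.
\<close>

lemma intercalate_A_B:
  assumes "(i, j, k) \<in> A m"
  shows "\<exists>i' j' l. (i', j', k) \<in> A m - H m (A m) \<and>
      (i', j, l) \<in> B m - G m (B m) \<and> (i, j', l) \<in> B m - G m (B m)"
      (is "\<exists>i' j' l. ?H i' j' l")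
    and "\<exists>i' j' l. (i', j', k) \<in> A m - J m (A m) \<and>
      (i', j, l) \<in> B m - G m (B m) \<and> (i, j', l) \<in> B m - G m (B m)"
      (is "\<exists>i' j' l. ?J i' j' l")
proof -
  \<comment> \<open>Row 0 and column 0 of \<open>A m\<close> avoid both \<open>H\<close> and
    \<open>J\<close>, so one witness serves both claims; the two cells of \<open>B m\<close> have
    coordinate sum \<open>i\<close> or \<open>j\<close>, which is below \<open>m\<close> and hence
    outside \<open>G\<close>.\<close>
  let ?Q = "\<lambda>i' j' l. (i', j', k) \<in> A m - H m (A m) \<and> (i', j', k) \<in> A m - J m (A m) \<and>
    (i', j, l) \<in> B m - G m (B m) \<and> (i, j', l) \<in> B m - G m (B m)"
  have lt: "i < m" "j < m" "k < m" and eq: "i = j + k \<or> i + m = j + k"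
    using assms by (simp_all add: mem_A)
  have "\<exists>i' j' l. ?Q i' j' l"
  proof (cases "j \<le> i")
    case True
    show ?thesis
      by (rule exI[of _ "i - j"], rule exI[of _ 0], rule exI[of _ i], simp only: Diff_iff mem_blocks mem_partial)
        (use True lt eq in linarith)
  next
    case False
    show ?thesis
      by (rule exI[of _ 0], rule exI[of _ "j - i"], rule exI[of _ j], simp only: Diff_iff mem_blocks mem_partial)
        (use False lt eq in linarith)
  qed
  then obtain i' j' l where *: "?Q i' j' l" by (elim exE)
  show "\<exists>i' j' l. ?H i' j' l" by (intro exI[of _ i'] exI[of _ j'] exI[of _ l]) (use * in simp)
  show "\<exists>i' j' l. ?J i' j' l" by (intro exI[of _ i'] exI[of _ j'] exI[of _ l]) (use * in simp)
qed

lemma intercalate_AT_B: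
  assumes "(i, j, k) \<in> AT m"
  shows "\<exists>i' j' l. (i', j', k) \<in> AT m - H m (AT m) \<and>
    (i', j, l) \<in> B m - G m (B m) \<and> (i, j', l) \<in> B m - G m (B m)"
proof -
  have lt: "i < m" "j < m" "k < m" and eq: "j = i + k \<or> j + m = i + k"
    using assms by (simp_all add: mem_AT)
  show ?thesis
  proof (cases "j \<le> i")
    case True
    show ?thesis
      by (rule exI[of _ "i - j"], rule exI[of _ 0], rule exI[of _ i], simp only: Diff_iff mem_blocks mem_partial)
        (use True lt eq in linarith)
  next
    case False
    show ?thesis
      by (rule exI[of _ 0], rule exI[of _ "j - i"], rule exI[of _ j], simp only: Diff_iff mem_blocks mem_partial)
        (use False lt eq in linarith)
  qed
qed

lemma intercalate_AT_A:
  assumes "(i, j, k) \<in> AT m"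
  shows "\<exists>i' j' l. (i', j', k) \<in> A m - H m (A m) \<and>
    (i', j, l) \<in> AT m - H m (AT m) \<and> (i, j', l) \<in> A m - J m (A m)"
proof -
  have lt: "i < m" "j < m" "k < m" and eq: "j = i + k \<or> j + m = i + k"
    using assms by (simp_all add: mem_AT)
  \<comment> \<open>The side entries must avoid \<open>H m (AT m)\<close> and
    \<open>J m (A m)\<close>, which lie on opposite sides of the diagonal, hence the finer split:
    column 0 of the opposite block serves cases 1 and 4, its row 0 cases 2 and 3.\<close>
  consider "j = 0" | "0 < j" "j \<le> i" | "i = 0" "0 < j" | "0 < i" "i < j" by linarith
  then show ?thesis
  proof cases
    case 1
    show ?thesis
      by (rule exI[of _ k], rule exI[of _ 0], rule exI[of _ i], simp only: Diff_iff mem_blocks mem_partial)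
        (use 1 lt eq in linarith)
  next
    case 2
    show ?thesis
      by (rule exI[of _ 0], rule exI[of _ "i - j"], rule exI[of _ j], simp only: Diff_iff mem_blocks mem_partial)
        (use 2 lt eq in linarith)
  next
    case 3
    show ?thesis
      by (rule exI[of _ 0], rule exI[of _ "m - j"], rule exI[of _ j], simp only: Diff_iff mem_blocks mem_partial)
        (use 3 lt eq in linarith)
  next
    case 4
    show ?thesis
      by (rule exI[of _ k], rule exI[of _ 0], rule exI[of _ i], simp only: Diff_iff mem_blocks mem_partial)
        (use 4 lt eq in linarith)
  qed
qed

lemma latin_square_full_block:
  assumes "m > 0" "x < 4" "y < 4"
  shows "latin_square m (full_block m x y)"
  using assms(2,3) critical_set_blocks[OF assms(1), THEN critical_setD(1)] unfolding less_4
  by (elim disjE; hypsubst; simp only: full_block_simps)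

text \<open>Collects all that depends on the individual block, so that the main argument can treat
  an arbitrary position.\<close>

lemma block_dichotomy:
  assumes m: "m > 0" and xy: "x < 4" "y < 4"
  shows "critical_set m (full_block m x y) (part_block m x y) \<or>
    part_block m x y = full_block m x y \<and>
    (\<exists>x'<4. \<exists>y'<4. x' \<noteq> x \<and> y' \<noteq> y \<and> xor4 x' y' = xor4 x y \<and> xor4 x' y = xor4 x y' \<and>
      (\<forall>i j k. (i, j, k) \<in> full_block m x y \<longrightarrow>
        (\<exists>i' j' l. (i', j', k) \<in> full_block m x' y' - part_block m x' y' \<and>
          (i', j, l) \<in> full_block m x' y - part_block m x' y \<and>
          (i, j', l) \<in> full_block m x y' - part_block m x y')))"
    (is "?C x y \<or> ?F x y \<and> (\<exists>x'<4. \<exists>y'<4. ?I x y x' y')")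
proof -
  note simps = full_block_simps part_block_simps xor4_simps
  have crit: "?C 0 0" "?C 0 1" "?C 0 2" "?C 0 3" "?C 1 0" "?C 1 2" "?C 2 0" "?C 2 1" "?C 3 0"
    by (simp_all only: simps critical_set_blocks[OF m])
  have F: "?F 1 1" "?F 1 3" "?F 2 2" "?F 2 3" "?F 3 1" "?F 3 2" "?F 3 3"
    by (simp_all only: simps)
  have ne: "0 \<noteq> (1 :: nat)" "0 \<noteq> (2 :: nat)" "0 \<noteq> (3 :: nat)" "1 \<noteq> (2 :: nat)" "1 \<noteq> (3 :: nat)"
    "2 \<noteq> (1 :: nat)" "2 \<noteq> (3 :: nat)" by simp_all
  \<comment> \<open>Each filled block is paired with a partial block of the same group for which
    both side blocks are partial as well; the side blocks are of type \<open>B\<close> except for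
    positions \<open>(1, 1)\<close> and \<open>(2, 2)\<close>.\<close>
  have I: "?I 1 1 0 0" "?I 2 2 0 0" "?I 3 3 0 0" "?I 1 3 0 2" "?I 2 3 0 1" "?I 3 1 2 0" "?I 3 2 1 0"
    unfolding simps
    by (intro conjI allI impI refl ne ne[THEN not_sym], erule intercalate_A_B intercalate_AT_A intercalate_AT_B)+
  have I': "\<exists>x'<4. \<exists>y'<4. ?I x y x' y'" if "?I x y x' y'" "x' < 4" "y' < 4" for x y x' y'
    using that by blast
  have E: "\<exists>x'<4. \<exists>y'<4. ?I 1 1 x' y'" "\<exists>x'<4. \<exists>y'<4. ?I 2 2 x' y'" "\<exists>x'<4. \<exists>y'<4. ?I 3 3 x' y'"
    "\<exists>x'<4. \<exists>y'<4. ?I 1 3 x' y'" "\<exists>x'<4. \<exists>y'<4. ?I 2 3 x' y'" "\<exists>x'<4. \<exists>y'<4. ?I 3 1 x' y'"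
    "\<exists>x'<4. \<exists>y'<4. ?I 3 2 x' y'"
    by ((rule I', rule I; simp)+)
  show ?thesis
    using xy unfolding less_4[of x] less_4[of y]
    by (elim disjE; hypsubst) ((rule disjI1, rule crit) | (rule disjI2, rule conjI, rule F, rule E))+
qed

lemma card_part_block:
  "2 * card (H m (A m)) + m = m\<^sup>2" "2 * card (H m (AT m)) + m = m\<^sup>2"
  "2 * card (J m (A m)) + m = m\<^sup>2" "2 * card (G m (B m)) + m = m\<^sup>2"
proof -
  have "triangle m \<subseteq> {..<m} \<times> {..<m} \<times> {..<m}" unfolding triangle_def by blast
  note * = card_isotope[OF this]
  show "2 * card (H m (A m)) + m = m\<^sup>2" "2 * card (H m (AT m)) + m = m\<^sup>2"
    "2 * card (J m (A m)) + m = m\<^sup>2" "2 * card (G m (B m)) + m = m\<^sup>2"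
    unfolding partial_blocks_eq_isotope *[OF inverses_inst(1,2,3)] *[OF inverses_inst(1,2,4)]
      *[OF inverses_inst(2,1,4)] *[OF inverses_inst(1,1,3)] by (rule card_triangle)+
qed

lemma part_block_subset:
  assumes "m > 0" "x < 4" "y < 4"
  shows "part_block m x y \<subseteq> full_block m x y"
  using block_dichotomy[OF assms] critical_setD(2) by (metis psubset_imp_subset order_refl)

section \<open>Size and criticality of \<open>P m\<close>\<close>

text \<open>Seven filled blocks contribute \<open>m\<^sup>2\<close> entries each and nine triangles
  \<open>(m\<^sup>2 - m) / 2\<close> each.\<close>

lemma card_P:
  assumes "m > 0"
  shows "real (card (P m)) = (23 * (real m)\<^sup>2 - 9 * real m) / 2"
proof -
  have sub: "part_block m x y \<subseteq> {..<m} \<times> {..<m} \<times> {..<m}" if "x < 4" "y < 4" for x y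
    using part_block_subset[OF assms that] latin_squareD(1)[OF latin_square_full_block[OF assms that]]
    by (rule subset_trans)
  have full: "card (A m) = m\<^sup>2" "card (AT m) = m\<^sup>2"
    using critical_set_blocks[OF assms, THEN critical_setD(1)] by (simp_all add: latin_square_def)
  have "card (P m) = (\<Sum>x<4. \<Sum>y<4. card (part_block m x y))"
    unfolding P_eq_assemble using sub by (rule card_assemble)
  then have "card (P m) = 2 * card (H m (AT m)) + card (H m (A m)) + 2 * card (J m (A m))
      + 4 * card (G m (B m)) + 7 * m\<^sup>2"
    by (simp add: lessThan_4 part_block_simps full del: One_nat_def)
  then have "2 * card (P m) + 9 * m = 23 * m\<^sup>2" using card_part_block[of m] by linarith
  then have "2 * real (card (P m)) + 9 * real m = 23 * (real m)\<^sup>2"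
    by (metis (mono_tags) of_nat_add of_nat_mult of_nat_numeral of_nat_power)
  then show ?thesis by (simp add: field_simps)
qed

lemma critical_set_P:
  assumes m: "m > 0"
  shows "critical_set (4 * m) (L' m) (P m)"
proof (rule critical_setI)
  note full_latin = latin_square_full_block[OF m]
  note part_full = part_block_subset[OF m]
  have full_sub: "full_block m x y \<subseteq> {..<m} \<times> {..<m} \<times> {..<m}" if "x < 4" "y < 4" for x y
    using latin_squareD(1)[OF full_latin[OF that]] .
  have part_sub: "part_block m x y \<subseteq> {..<m} \<times> {..<m} \<times> {..<m}" if "x < 4" "y < 4" for x y
    using part_full[OF that] full_sub[OF that] by (rule subset_trans)
  note mem_L' = mem_assemble[of "full_block m" m, OF full_sub, folded L'_eq_assemble]
  note mem_P = mem_assemble[of "part_block m" m, OF part_sub, folded P_eq_assemble]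
  show L': "latin_square (4 * m) (L' m)"
    unfolding L'_eq_assemble using full_latin by (rule latin_square_assemble)
  have P_sub: "P m \<subseteq> L' m"
  proof
    fix e assume "e \<in> P m"
    then obtain x y i j k where *: "x < 4" "y < 4" "(i, j, k) \<in> part_block m x y"
      "e = (x * m + i, y * m + j, xor4 x y * m + k)" unfolding P_eq_assemble by (rule assembleE)
    show "e \<in> L' m"
      unfolding L'_eq_assemble *(4) using part_full[OF *(1,2)] *(3) by (intro assembleI[OF *(1,2)]) blast
  qed
  \<comment> \<open>\<open>H\<close> omits column 0, so this cell shows that the inclusion is
    proper.\<close>
  have "(0, 0, 0) \<in> full_block m 0 0" "(0, 0, 0) \<notin> part_block m 0 0"
    unfolding full_block_simps part_block_simps mem_partial mem_A using m by simp_all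
  then have "(0, 0, 0) \<in> L' m" "(0, 0, 0) \<notin> P m"
    using mem_L'[of 0 0 0 0 0] mem_P[of 0 0 0 0 0] m by (simp_all add: xor4_simps)
  then show "P m \<subset> L' m" using P_sub by blast
  show "L' m \<subseteq> M" if M: "latin_square (4 * m) M" and sub: "P m \<subseteq> M" for M
  proof -
    have filled: "pure m M x y (xor4 x y)"
      if "x < 4" "y < 4" "part_block m x y = full_block m x y" for x y
      by (rule pure_of_filled[OF M full_latin[OF that(1,2)]])
        (use assembleI[of x y _ _ _ "part_block m" m] that sub in \<open>auto simp: P_eq_assemble\<close>)
    have "pure m M 1 1 0" "pure m M 1 3 2" "pure m M 2 2 0" "pure m M 2 3 1"
      "pure m M 3 1 2" "pure m M 3 2 1" "pure m M 3 3 0"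
      using filled[of 1 1] filled[of 1 3] filled[of 2 2] filled[of 2 3] filled[of 3 1] filled[of 3 2]
        filled[of 3 3]
      by (simp_all add: xor4_simps full_block_simps part_block_simps del: One_nat_def)
    note pure = pure_all_blocks[OF M this]
    show ?thesis
    proof
      fix e assume "e \<in> L' m"
      then obtain x y i j k where *: "x < 4" "y < 4" "(i, j, k) \<in> full_block m x y"
        "e = (x * m + i, y * m + j, xor4 x y * m + k)" unfolding L'_eq_assemble by (rule assembleE)
      let ?N = "block m M x y (xor4 x y)"
      have N: "latin_square m ?N" by (rule latin_square_block[OF M pure[OF *(1,2)] *(1,2)])
      have "part_block m x y \<subseteq> ?N"
      proof
        fix t assume t: "t \<in> part_block m x y"
        obtain a b c where abc: "t = (a, b, c)" by (metis prod_cases3)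
        have "(x * m + a, y * m + b, xor4 x y * m + c) \<in> M"
          using assembleI[OF *(1,2), of a b c "part_block m" m] t abc sub unfolding P_eq_assemble by blast
        moreover have "a < m" "b < m" "c < m" using t abc part_sub[OF *(1,2)] by blast+
        ultimately show "t \<in> ?N" by (simp add: abc block_def)
      qed
      \<comment> \<open>A partial block is settled by the uniqueness half of its criticality; a
        filled block is contained in \<open>?N\<close> and so equals it.\<close>
      then have "?N = full_block m x y"
        using block_dichotomy[OF m *(1,2)] critical_setD(3)[OF _ N]
          latin_square_eqI[OF full_latin[OF *(1,2)] N] by metis
      then have "(i, j, k) \<in> ?N" using *(3) by simp
      then show "e \<in> M" by (simp add: *(4) block_def)
    qed
  qed
  fix t assume "t \<in> P m"
  then obtain x y i j k where xy: "x < 4" "y < 4" and t: "(i, j, k) \<in> part_block m x y"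
    "t = (x * m + i, y * m + j, xor4 x y * m + k)" unfolding P_eq_assemble by (rule assembleE)
  from block_dichotomy[OF m xy]
  show "\<exists>M. latin_square (4 * m) M \<and> P m - {t} \<subseteq> M \<and> M \<noteq> L' m"
  proof (elim disjE conjE exE)
    assume "critical_set m (full_block m x y) (part_block m x y)"
    then obtain N where N: "latin_square m N" "part_block m x y - {(i, j, k)} \<subseteq> N" "N \<noteq> full_block m x y"
      using critical_setD(4)[OF _ t(1)] by blast
    \<comment> \<open>Only the block of \<open>t\<close> is exchanged, within its own group of
      symbols, so the assembled square stays Latin.\<close>
    define Q where "Q x' y' = (if x' = x \<and> y' = y then N else full_block m x' y')" for x' y'
    have Q: "latin_square m (Q x' y')" if "x' < 4" "y' < 4" for x' y'
      using full_latin[OF that] N(1) by (simp add: Q_def)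
    have "P m - {t} \<subseteq> assemble m Q"
    proof
      fix e assume e: "e \<in> P m - {t}"
      then have "e \<in> P m" by blast
      then obtain x' y' i' j' k' where *: "x' < 4" "y' < 4" "(i', j', k') \<in> part_block m x' y'"
        "e = (x' * m + i', y' * m + j', xor4 x' y' * m + k')" unfolding P_eq_assemble by (rule assembleE)
      have "(i', j', k') \<in> Q x' y'"
      proof (cases "x' = x \<and> y' = y")
        case True
        then have "(i', j', k') \<noteq> (i, j, k)" using e *(4) t(2) by auto
        then show ?thesis using True *(3) N(2) by (auto simp: Q_def)
      next
        case False
        then have "Q x' y' = full_block m x' y'" unfolding Q_def by (rule if_not_P)
        then show ?thesis using *(3) part_full[OF *(1,2)] by blast
      qed
      then show "e \<in> assemble m Q" unfolding *(4) by (rule assembleI[OF *(1,2)])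
    qed
    moreover have "assemble m Q \<noteq> L' m"
    proof
      assume eq: "assemble m Q = L' m"
      have Qxy: "Q x y = N" by (simp add: Q_def)
      have "N \<subseteq> full_block m x y"
      proof
        fix e assume e: "e \<in> N"
        obtain a b c where abc: "e = (a, b, c)" by (metis prod_cases3)
        then have lt: "a < m" "b < m" "c < m" using latin_squareD(2)[OF N(1)] e by blast+
        have "(x * m + a, y * m + b, xor4 x y * m + c) \<in> L' m"
          using assembleI[OF xy, of a b c Q m] e abc Qxy eq by simp
        then show "e \<in> full_block m x y" using mem_L'[OF _ _ xy lt] abc by simp
      qed
      then show False using latin_square_eqI[OF N(1) full_latin[OF xy]] N(3) by blast
    qed
    moreover have "latin_square (4 * m) (assemble m Q)" using Q by (rule latin_square_assemble)
    ultimately show ?thesis by blast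
  next
    fix x' y'
    assume part: "part_block m x y = full_block m x y"
      and xy': "x' < 4" "y' < 4" "x' \<noteq> x" "y' \<noteq> y" "xor4 x' y' = xor4 x y" "xor4 x' y = xor4 x y'"
      and "\<forall>i j k. (i, j, k) \<in> full_block m x y \<longrightarrow>
        (\<exists>i' j' l. (i', j', k) \<in> full_block m x' y' - part_block m x' y' \<and>
          (i', j, l) \<in> full_block m x' y - part_block m x' y \<and>
          (i, j', l) \<in> full_block m x y' - part_block m x y')"
    then obtain i' j' l where q: "(i', j', k) \<in> full_block m x' y' - part_block m x' y'"
      "(i', j, l) \<in> full_block m x' y - part_block m x' y"
      "(i, j', l) \<in> full_block m x y' - part_block m x y'"
      using t(1) by metis
    have lt: "i < m" "j < m" "k < m" "i' < m" "j' < m" "l < m"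
      using t(1) q part full_sub[OF xy] full_sub[OF xy'(1,2)] full_sub[OF xy(1) xy'(2)] by blast+
    have new: "(a * m + c, b * m + d, xor4 a b * m + e) \<in> L' m - P m"
      if "a < 4" "b < 4" "c < m" "d < m" "e < m" "(c, d, e) \<in> full_block m a b - part_block m a b" for a b c d e
      using mem_L'[OF _ _ that(1-5)] mem_P[OF _ _ that(1-5)] that(6) by simp
    \<comment> \<open>The two \<open>xor4\<close> equations put opposite corners into the same
      symbol group, so the four entries form an intercalate of \<open>L' m\<close>.\<close>
    let ?s = "xor4 x y * m + k" and ?u = "xor4 x y' * m + l"
    have *: "(x' * m + i', y' * m + j', ?s) \<in> L' m - P m"
      "(x' * m + i', y * m + j, ?u) \<in> L' m - P m" "(x * m + i, y' * m + j', ?u) \<in> L' m - P m"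
      using new[OF xy'(1,2) lt(4,5,3) q(1)] new[OF xy'(1) xy(2) lt(4,2,6) q(2)]
        new[OF xy(1) xy'(2) lt(1,5,6) q(3)] by (simp_all only: xy'(5,6))
    have t': "(x * m + i, y * m + j, ?s) \<in> L' m" using \<open>t \<in> P m\<close> P_sub t(2) by blast
    have ne: "x * m + i \<noteq> x' * m + i'" "y * m + j \<noteq> y' * m + j'"
      using block_index_inj(1)[OF lt(1,4)] block_index_inj(1)[OF lt(2,5)] xy'(3,4) by metis+
    obtain M where M: "latin_square (4 * m) M" "M \<noteq> L' m"
      "L' m - {(x * m + i, y * m + j, ?s), (x' * m + i', y' * m + j', ?s),
         (x * m + i, y' * m + j', ?u), (x' * m + i', y * m + j, ?u)} \<subseteq> M"
      using intercalate_switch[OF L' t' _ _ _ ne, of ?u] * by blast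
    \<comment> \<open>Of the four switched entries only \<open>t\<close> belongs to
      \<open>P m\<close>.\<close>
    have "P m - {t} \<subseteq> M" using M(3) P_sub * t(2) by blast
    then show ?thesis using M by blast
  qed
qed

text \<open>The bound \<open>n\<^sup>2\<close> on sizes makes the set finite, which is what gives
  \<open>Max\<close> its meaning.\<close>

lemma card_le_lcs:
  assumes "critical_set n L C"
  shows "card C \<le> lcs n"
  unfolding lcs_def
proof (rule Max_ge)
  have "card C' \<le> n\<^sup>2" if "critical_set n L C'" for L C'
    using critical_setD(1,2)[OF that] finite_latin_square card_mono
    unfolding latin_square_def by (metis psubset_imp_subset)
  then have "{card C | C L. critical_set n L C} \<subseteq> {..n\<^sup>2}" by blast
  then show "finite {card C | C L. critical_set n L C}" by (rule finite_subset) simp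
  show "card C \<in> {card C | C L. critical_set n L C}" using assms by blast
qed

theorem theorem4:
  fixes m :: nat
  assumes "m > 0"
  shows "latin_square (4 * m) (L' m)
    \<and> critical_set (4 * m) (L' m) (P m)
    \<and> real (card (P m)) = (23 * (real m)\<^sup>2 - 9 * real m) / 2
    \<and> real (lcs (4 * m)) \<ge> (23 * (real m)\<^sup>2 - 9 * real m) / 2"
proof (intro conjI)
  show crit: "critical_set (4 * m) (L' m) (P m)" using assms by (rule critical_set_P)
  then show "latin_square (4 * m) (L' m)" by (rule critical_setD(1))
  show card: "real (card (P m)) = (23 * (real m)\<^sup>2 - 9 * real m) / 2"
    using assms by (rule card_P)
  show "real (lcs (4 * m)) \<ge> (23 * (real m)\<^sup>2 - 9 * real m) / 2"
    using card_le_lcs[OF crit] card by linarith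
qed

end
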